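(* Let $X$ be a Tychonoff space. The following are equivalent: (1) $B(X)$ is sequentially separable and satisfies $S_{1}(\mathcal{S},\mathcal{D})$; (2) $X$ satisfies $S_{1}(\mathcal{B}_{\Gamma},\mathcal{B}_{\Omega})$ and $X$ has the $O$-property; (3) $B(X)$ is sequentially separable and satisfies $S_{1}(\Gamma_f,\Omega_f)$ for every $f\in B(X)$; (4) $B(X)$ is sequentially separable and satisfies $S_{1}(\mathcal{S},\Omega_f)$ for every $f\in B(X)$; (5) $B(X)$ is sequentially separable and satisfies $S_{fin}(\mathcal{S},\mathcal{D})$; (6) $B(X)$ is sequentially separable and satisfies $U_{fin}(\mathcal{S},\mathcal{D})$; (7) $B(X)$ is sequentially separable and satisfies $S_{fin}(\mathcal{S},\Omega_f)$ for every $f\in B(X)$; (8) $B(X)$ is sequentially separable and satisfies $U_{fin}(\mathcal{S},\Omega_f)$ for every $f\in B(X)$.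
   Context: $B(X)$ is the set of all Baire functions on $X$, i.e. the smallest class of functions $X\to\mathbb{R}$ containing all continuous functions and closed under pointwise limits of sequences, with the topology of pointwise convergence (subspace topology from $\mathbb{R}^X$). A Baire set of $X$ is a member of the $\sigma$-algebra generated by the zero-sets of continuous real-valued functions on $X$. Covers are nontrivial: $X$ is not a member of the cover. An $\omega$-cover of $X$ is a family $\mathcal{U}$ of subsets of $X$ with $X\notin\mathcal{U}$ such that every finite subset of $X$ is contained in a member of $\mathcal{U}$. A $\gamma$-cover is an infinite cover $\mathcal{U}$ such that each $x\in X$ belongs to all but finitely many elements of $\mathcal{U}$. $\mathcal{B}_{\Omega}$ (resp. $\mathcal{B}_{\Gamma}$) is the family of countable $\omega$-covers (resp. $\gamma$-covers) of $X$ by Baire sets. $X$ has the $O$-property if there is a bijection $\varphi$ from $X$ onto a separable metrizable space $Y$ such that $\varphi^{-1}(U)$ is a Baire set of $X$ for every open $U\subseteq Y$, and $\varphi(T)$ is an $F_\sigma$-set of $Y$ for every Baire set $T$ of $X$. A subset $D$ of a space $Y$ is sequentially dense if every point of $Y$ is the limit of a sequence of points of $D$; $Y$ is sequentially separable if it has a countable sequentially dense subset. $\mathcal{D}$ (resp. $\mathcal{S}$) is the family of countable dense (resp. countable sequentially dense) subsets of $B(X)$. For $f\in B(X)$: $\Omega_f$ is the family of $A\subseteq B(X)$ with $f\in\overline{A}\setminus A$; $\Gamma_f$ is the family of countably infinite $A\subseteq B(X)$ with $f\notin A$ such that $A\setminus U$ is finite for each neighborhood $U$ of $f$. $S_1(\mathcal{P},\mathcal{Q})$: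 for each sequence $(A_n)_{n\in\omega}$ of elements of $\mathcal{P}$ there are $b_n\in A_n$ such that $\{b_n:n\in\omega\}\in\mathcal{Q}$. $S_{fin}(\mathcal{P},\mathcal{Q})$: for each sequence $(A_n)_{n\in\omega}$ of elements of $\mathcal{P}$ there are finite sets $B_n\subseteq A_n$ such that $\bigcup_{n\in\omega}B_n\in\mathcal{Q}$. $U_{fin}(\mathcal{S},\Omega_f)$: for each sequence $(S_n)_{n\in\omega}$ of elements of $\mathcal{S}$ there are finite $F_n\subseteq S_n$ such that for every finite $K\subseteq X$ and every $\epsilon>0$ there is $n\in\omega$ such that for each $x\in K$ there is $g\in F_n$ with $|g(x)-f(x)|<\epsilon$. $U_{fin}(\mathcal{S},\mathcal{D})$: for each sequence $(S_n)_{n\in\omega}$ of elements of $\mathcal{S}$ there are finite $F_n\subseteq S_n$ such that for every $f\in B(X)$, every finite $K\subseteq X$ and every $\epsilon>0$ there is $n\in\omega$ such that for each $x\in K$ there is $g\in F_n$ with $|g(x)-f(x)|<\epsilon$. *)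

theory Defs
  imports "HOL-Analysis.Analysis"
begin

section \<open>Baire functions and Baire sets\<close>

text \<open>Real functions on a space \<open>X\<close> are represented by functions that are extensional on
  \<open>topspace X\<close>, so that they are the points of \<open>powertop_real (topspace X)\<close>.\<close>

inductive_set baire_functions :: "'a topology \<Rightarrow> ('a \<Rightarrow> real) set" for X where
  continuous:
    "\<lbrakk>f \<in> extensional (topspace X); continuous_map X euclideanreal f\<rbrakk>
      \<Longrightarrow> f \<in> baire_functions X"
| pointwise_limit:
    "\<lbrakk>\<And>n::nat. g n \<in> baire_functions X; f \<in> extensional (topspace X);
      \<And>x. x \<in> topspace X \<Longrightarrow> (\<lambda>n. g n x) \<longlonglongrightarrow> f x\<rbrakk>
      \<Longrightarrow> f \<in> baire_functions X"

definition baire_function_space :: "'a topology \<Rightarrow> ('a \<Rightarrow> real) topology" where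
  "baire_function_space X = subtopology (powertop_real (topspace X)) (baire_functions X)"

definition zero_sets :: "'a topology \<Rightarrow> 'a set set" where
  "zero_sets X = {{x \<in> topspace X. f x = 0} | f. continuous_map X euclideanreal f}"

definition baire_sets :: "'a topology \<Rightarrow> 'a set set" where
  "baire_sets X = sigma_sets (topspace X) (zero_sets X)"

text \<open>Since \<open>\<phi>\<close> is a bijection, the topology of \<open>Y\<close> can always be transported to a topology
  on the points of \<open>X\<close>; letting \<open>Y\<close> range over topologies on the type \<open>'a\<close> is therefore
  no restriction.\<close>

definition O_property :: "'a topology \<Rightarrow> bool" where
  "O_property X \<longleftrightarrow>
    (\<exists>(Y :: 'a topology) \<phi>.
        separable_space Y \<and> metrizable_space Y \<and>
        bij_betw \<phi> (topspace X) (topspace Y) \<and>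
        (\<forall>U. openin Y U \<longrightarrow> {x \<in> topspace X. \<phi> x \<in> U} \<in> baire_sets X) \<and>
        (\<forall>T \<in> baire_sets X. fsigma_in Y (\<phi> ` T)))"

section \<open>Covers\<close>

definition omega_cover :: "'a set \<Rightarrow> 'a set set \<Rightarrow> bool" where
  "omega_cover S \<U> \<longleftrightarrow>
    \<U> \<subseteq> Pow S \<and> S \<notin> \<U> \<and> (\<forall>K. finite K \<and> K \<subseteq> S \<longrightarrow> (\<exists>U\<in>\<U>. K \<subseteq> U))"

definition gamma_cover :: "'a set \<Rightarrow> 'a set set \<Rightarrow> bool" where
  "gamma_cover S \<U> \<longleftrightarrow>
    \<U> \<subseteq> Pow S \<and> S \<notin> \<U> \<and> \<Union>\<U> = S \<and> infinite \<U> \<and> (\<forall>x\<in>S. finite {U \<in> \<U>. x \<notin> U})"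

definition baire_Omega :: "'a topology \<Rightarrow> 'a set set set" where
  "baire_Omega X = {\<U>. countable \<U> \<and> \<U> \<subseteq> baire_sets X \<and> omega_cover (topspace X) \<U>}"

definition baire_Gamma :: "'a topology \<Rightarrow> 'a set set set" where
  "baire_Gamma X = {\<U>. countable \<U> \<and> \<U> \<subseteq> baire_sets X \<and> gamma_cover (topspace X) \<U>}"

section \<open>Families of subsets of a topological space\<close>

definition sequentially_dense_in :: "'b topology \<Rightarrow> 'b set \<Rightarrow> bool" where
  "sequentially_dense_in Y D \<longleftrightarrow>
    D \<subseteq> topspace Y \<and>
    (\<forall>y \<in> topspace Y. \<exists>s :: nat \<Rightarrow> 'b. range s \<subseteq> D \<and> limitin Y s y sequentially)"

definition countable_dense_sets :: "'b topology \<Rightarrow> 'b set set" where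
  "countable_dense_sets Y =
    {D. countable D \<and> D \<subseteq> topspace Y \<and> Y closure_of D = topspace Y}"

definition countable_seq_dense_sets :: "'b topology \<Rightarrow> 'b set set" where
  "countable_seq_dense_sets Y = {D. countable D \<and> sequentially_dense_in Y D}"

definition sequentially_separable :: "'b topology \<Rightarrow> bool" where
  "sequentially_separable Y \<longleftrightarrow> (\<exists>D. countable D \<and> sequentially_dense_in Y D)"

definition Omega_at :: "'b topology \<Rightarrow> 'b \<Rightarrow> 'b set set" where
  "Omega_at Y f = {A. A \<subseteq> topspace Y \<and> f \<in> Y closure_of A - A}"

definition Gamma_at :: "'b topology \<Rightarrow> 'b \<Rightarrow> 'b set set" where
  "Gamma_at Y f =
    {A. A \<subseteq> topspace Y \<and> countable A \<and> infinite A \<and> f \<notin> A \<and>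
        (\<forall>U. openin Y U \<and> f \<in> U \<longrightarrow> finite (A - U))}"

section \<open>Selection principles\<close>

definition S_one :: "'c set set \<Rightarrow> 'c set set \<Rightarrow> bool" where
  "S_one P Q \<longleftrightarrow>
    (\<forall>A :: nat \<Rightarrow> 'c set. (\<forall>n. A n \<in> P) \<longrightarrow> (\<exists>b. (\<forall>n. b n \<in> A n) \<and> range b \<in> Q))"

definition S_fin :: "'c set set \<Rightarrow> 'c set set \<Rightarrow> bool" where
  "S_fin P Q \<longleftrightarrow>
    (\<forall>A :: nat \<Rightarrow> 'c set. (\<forall>n. A n \<in> P) \<longrightarrow>
      (\<exists>B. (\<forall>n. finite (B n) \<and> B n \<subseteq> A n) \<and> (\<Union>n. B n) \<in> Q))"

definition U_fin_seq_dense_Omega_at :: "'a topology \<Rightarrow> ('a \<Rightarrow> real) \<Rightarrow> bool" where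
  "U_fin_seq_dense_Omega_at X f \<longleftrightarrow>
    (\<forall>S :: nat \<Rightarrow> ('a \<Rightarrow> real) set.
      (\<forall>n. S n \<in> countable_seq_dense_sets (baire_function_space X)) \<longrightarrow>
      (\<exists>F. (\<forall>n. finite (F n) \<and> F n \<subseteq> S n) \<and>
        (\<forall>K \<epsilon>. finite K \<and> K \<subseteq> topspace X \<and> \<epsilon> > 0 \<longrightarrow>
          (\<exists>n. \<forall>x\<in>K. \<exists>g\<in>F n. \<bar>g x - f x\<bar> < \<epsilon>))))"

definition U_fin_seq_dense_dense :: "'a topology \<Rightarrow> bool" where
  "U_fin_seq_dense_dense X \<longleftrightarrow>
    (\<forall>S :: nat \<Rightarrow> ('a \<Rightarrow> real) set.
      (\<forall>n. S n \<in> countable_seq_dense_sets (baire_function_space X)) \<longrightarrow>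
      (\<exists>F. (\<forall>n. finite (F n) \<and> F n \<subseteq> S n) \<and>
        (\<forall>f K \<epsilon>. f \<in> baire_functions X \<and> finite K \<and> K \<subseteq> topspace X \<and> \<epsilon> > 0 \<longrightarrow>
          (\<exists>n. \<forall>x\<in>K. \<exists>g\<in>F n. \<bar>g x - f x\<bar> < \<epsilon>))))"

definition all_equivalent :: "bool list \<Rightarrow> bool" where
  "all_equivalent Ps \<longleftrightarrow> (\<forall>P \<in> set Ps. \<forall>Q \<in> set Ps. P \<longleftrightarrow> Q)"

end

theory Submission
  imports Defs
begin

text \<open>
  \<^bold>\<open>Baire functions.\<close> The Baire functions are exactly the real functions that are measurable for
  the \<open>\<sigma>\<close>-algebra of Baire sets (\<open>baire_functions_eq\<close>). In particular, characteristic functions of Baire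
  sets are Baire functions, and functions patched together along Baire sets are, too.

  \<^bold>\<open>Sequential separability is the O-property.\<close> Evaluating at the members of a countable
  sequentially dense set embeds the points into \<open>\<real>\<^sup>\<omega>\<close>; in the induced topology every Baire set is
  \<open>F\<^sub>\<sigma>\<close>, because its characteristic function is a limit of a sequence of coordinates
  (\<open>sequentially_separable_imp_O_property\<close>). Conversely, if every Baire set is \<open>F\<^sub>\<sigma>\<close> for a
  topology with countable base \<open>U\<^sub>0, U\<^sub>1, \<dots>\<close>, then each Baire function \<open>f\<close> is a limit of functions
  that know only to which of \<open>U\<^sub>0, \<dots>, U\<^sub>m\<close> a point belongs and take rational values
  (\<open>trace_functions_sequentially_dense\<close>). There are only countably many such functions. They
  are obtained by guessing, from this finite information, the first closed set in a
  countable list to which the point can still belong; the guess is eventually correct.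

  \<^bold>\<open>From covers to functions.\<close> If \<open>a\<^sub>i \<rightarrow> f\<close> pointwise, then the sets on which \<open>a\<^sub>i\<close> is
  \<open>\<epsilon>\<close>-close to \<open>f\<close> contain each point for almost all \<open>i\<close>. Selecting an \<open>\<omega>\<close>-cover from such
  sequences of sets, with \<open>\<epsilon>\<close> tending to \<open>0\<close>, therefore selects functions that have \<open>f\<close> in their
  closure (\<open>select_close_to_limit\<close>). This gives all of the selection principles \<open>S\<^sub>1\<close> for functions,
  once the targets \<open>f\<close> are distributed suitably over the stages of the selection.

  \<^bold>\<open>From functions to covers.\<close> The weakest of the conditions is that with \<open>U\<^sub>f\<^sub>i\<^sub>n\<close> for the
  families \<open>\<Omega>\<^sub>f\<close>; the others imply it directly. It implies the selection principle for covers
  (\<open>U_fin_seq_dense_Omega_at_imp_S_one_covers\<close>) because a \<open>\<gamma>\<close>-cover may be replaced by the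
  increasing sequence of intersections of its tails, and such a sequence can be encoded in a
  sequentially dense set of functions by truncating functions off its members. A finite
  selection of functions corresponds to finitely many members of an increasing sequence, that is,
  to the largest of them.
\<close>

section \<open>Baire functions as measurable functions\<close>

definition baire_algebra :: "'a topology \<Rightarrow> 'a measure" where
  "baire_algebra X = sigma (topspace X) (zero_sets X)"

lemma zero_sets_subset: "zero_sets X \<subseteq> Pow (topspace X)"
  by (auto simp: zero_sets_def)

lemma space_baire_algebra [simp]: "space (baire_algebra X) = topspace X"
  and sets_baire_algebra [simp]: "sets (baire_algebra X) = baire_sets X"
  using zero_sets_subset[of X] by (simp_all add: baire_algebra_def baire_sets_def)

lemma baire_sets_subset: "T \<in> baire_sets X \<Longrightarrow> T \<subseteq> topspace X"
  using sets.sets_into_space[of T "baire_algebra X"] by simp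

lemma continuous_map_preimage_closed_in_baire_sets:
  assumes "continuous_map X euclideanreal f" "closed C"
  shows "{x \<in> topspace X. f x \<in> C} \<in> baire_sets X"
proof -
  define g where "g = (\<lambda>x. if C = {} then 1 else infdist (f x) C)"
  have "continuous_map euclideanreal euclideanreal (\<lambda>y. infdist y C)"
    by (simp add: continuous_on_infdist)
  from continuous_map_compose[OF assms(1) this]
  have "continuous_map X euclideanreal g"
    by (simp add: g_def o_def)
  moreover have "{x \<in> topspace X. f x \<in> C} = {x \<in> topspace X. g x = 0}"
    using assms(2) by (auto simp: g_def simp flip: in_closed_iff_infdist_zero split: if_splits)
  ultimately show ?thesis
    by (auto simp: baire_sets_def zero_sets_def intro!: sigma_sets.Basic)
qed

lemma continuous_map_borel_measurable_baire:
  assumes "continuous_map X euclideanreal f"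
  shows "f \<in> borel_measurable (baire_algebra X)"
proof (rule borel_measurableI)
  fix S :: "real set" assume "open S"
  have "f -` S \<inter> topspace X = topspace X - {x \<in> topspace X. f x \<in> - S}"
    by auto
  moreover have "{x \<in> topspace X. f x \<in> - S} \<in> baire_sets X"
    using continuous_map_preimage_closed_in_baire_sets assms \<open>open S\<close> by blast
  ultimately show "f -` S \<inter> space (baire_algebra X) \<in> sets (baire_algebra X)"
    using sets.compl_sets[of _ "baire_algebra X"] by simp
qed

lemma baire_function_extensional: "f \<in> baire_functions X \<Longrightarrow> f \<in> extensional (topspace X)"
  by (auto elim: baire_functions.cases)

lemma baire_function_measurable:
  "f \<in> baire_functions X \<Longrightarrow> f \<in> borel_measurable (baire_algebra X)"
proof (induction rule: baire_functions.induct)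
  case (continuous f)
  then show ?case
    by (simp add: continuous_map_borel_measurable_baire)
next
  case (pointwise_limit g f)
  show ?case
    by (rule borel_measurable_LIMSEQ_real[of _ g]) (use pointwise_limit in auto)
qed

text \<open>With one argument fixed, the functions that are admissible for the other argument
  contain the continuous ones and are closed under pointwise limits; so the induction over the
  Baire functions is nested, and the case of two continuous functions is its only real content.\<close>

lemma baire_functions_compose2:
  fixes F :: "real \<Rightarrow> real \<Rightarrow> real"
  assumes F: "continuous_on UNIV (\<lambda>z. F (fst z) (snd z))"
    and f: "f \<in> baire_functions X" and g: "g \<in> baire_functions X"
  shows "(\<lambda>x\<in>topspace X. F (f x) (g x)) \<in> baire_functions X"
  using f
proof induction
  case (continuous f)
  show ?case
    using g
  proof induction
    case (continuous g)
    have "continuous_map X (prod_topology euclideanreal euclideanreal) (\<lambda>x. (f x, g x))"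
      using continuous.hyps \<open>continuous_map X euclideanreal f\<close>
      unfolding continuous_map_pairwise by (simp add: o_def)
    moreover have "continuous_map (prod_topology euclideanreal euclideanreal) euclideanreal
        (\<lambda>z. F (fst z) (snd z))"
      using F by simp
    ultimately have "continuous_map X euclideanreal ((\<lambda>z. F (fst z) (snd z)) \<circ> (\<lambda>x. (f x, g x)))"
      by (rule continuous_map_compose)
    then have "continuous_map X euclideanreal (\<lambda>x\<in>topspace X. F (f x) (g x))"
      by (rule continuous_map_eq) auto
    with restrict_extensional show ?case
      by (rule baire_functions.continuous)
  next
    case (pointwise_limit h g)
    show ?case
    proof (rule baire_functions.pointwise_limit[OF pointwise_limit.IH])
      fix x assume "x \<in> topspace X"
      then have "(\<lambda>n. (f x, h n x)) \<longlonglongrightarrow> (f x, g x)"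
        using pointwise_limit by (intro tendsto_intros) auto
      then have "(\<lambda>n. (\<lambda>z. F (fst z) (snd z)) (f x, h n x)) \<longlonglongrightarrow> (\<lambda>z. F (fst z) (snd z)) (f x, g x)"
        using F by (intro continuous_on_tendsto_compose[of UNIV "\<lambda>z. F (fst z) (snd z)"]) auto
      then show "(\<lambda>n. (\<lambda>x\<in>topspace X. F (f x) (h n x)) x)
          \<longlonglongrightarrow> (\<lambda>x\<in>topspace X. F (f x) (g x)) x"
        using \<open>x \<in> topspace X\<close> by simp
    qed (rule restrict_extensional)
  qed
next
  case (pointwise_limit h f)
  show ?case
  proof (rule baire_functions.pointwise_limit[OF pointwise_limit.IH])
    fix x assume "x \<in> topspace X"
    then have "(\<lambda>n. (h n x, g x)) \<longlonglongrightarrow> (f x, g x)"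
      using pointwise_limit by (intro tendsto_intros) auto
    then have "(\<lambda>n. (\<lambda>z. F (fst z) (snd z)) (h n x, g x)) \<longlonglongrightarrow> (\<lambda>z. F (fst z) (snd z)) (f x, g x)"
      using F by (intro continuous_on_tendsto_compose[of UNIV "\<lambda>z. F (fst z) (snd z)"]) auto
    then show "(\<lambda>n. (\<lambda>x\<in>topspace X. F (h n x) (g x)) x)
        \<longlonglongrightarrow> (\<lambda>x\<in>topspace X. F (f x) (g x)) x"
      using \<open>x \<in> topspace X\<close> by simp
  qed (rule restrict_extensional)
qed

lemma baire_functions_restrict_compose2:
  fixes F :: "real \<Rightarrow> real \<Rightarrow> real"
  assumes F: "continuous_on UNIV (\<lambda>z. F (fst z) (snd z))"
    and "restrict f (topspace X) \<in> baire_functions X" "restrict g (topspace X) \<in> baire_functions X"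
  shows "(\<lambda>x\<in>topspace X. F (f x) (g x)) \<in> baire_functions X"
  using baire_functions_compose2[OF assms]
  by (rule back_subst[of "\<lambda>h. h \<in> baire_functions X"]) auto

lemma baire_functions_const: "(\<lambda>x\<in>topspace X. c) \<in> baire_functions X"
proof (rule baire_functions.continuous)
  have "continuous_map X euclideanreal (\<lambda>x. c)" by simp
  then show "continuous_map X euclideanreal (\<lambda>x\<in>topspace X. c)"
    by (rule continuous_map_eq) auto
qed auto

text \<open>Zero-sets are the start: \<open>max 0 (1 - n \<bar>f x\<bar>)\<close> tends to the characteristic function of
  the zero-set of \<open>f\<close>. The sets with a Baire characteristic function then form a
  \<open>\<sigma>\<close>-algebra because Baire functions admit differences, maxima and limits.\<close>

lemma baire_functions_indicator:
  assumes "T \<in> baire_sets X"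
  shows "(\<lambda>x\<in>topspace X. indicat_real T x) \<in> baire_functions X"
  using assms unfolding baire_sets_def
proof induction
  case (Basic Z)
  then obtain f where f: "continuous_map X euclideanreal f" "Z = {x \<in> topspace X. f x = 0}"
    by (auto simp: zero_sets_def)
  define g where "g n = (\<lambda>x\<in>topspace X. max 0 (1 - real n * \<bar>f x\<bar>))" for n
  have "continuous_map X euclideanreal (\<lambda>x. max 0 (1 - real n * \<bar>f x\<bar>))" for n
    by (intro continuous_intros f)
  then have "continuous_map X euclideanreal (g n)" for n
    by (rule continuous_map_eq) (simp add: g_def)
  then have "g n \<in> baire_functions X" for n
    by (intro baire_functions.continuous) (auto simp: g_def)
  then show ?case
  proof (rule baire_functions.pointwise_limit)
    fix x assume x: "x \<in> topspace X"
    show "(\<lambda>n. g n x) \<longlonglongrightarrow> (\<lambda>x\<in>topspace X. indicat_real Z x) x"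
    proof (cases "f x = 0")
      case False
      then obtain N where N: "real N * \<bar>f x\<bar> > 1"
        using reals_Archimedean3[of "\<bar>f x\<bar>"] by auto
      have "g n x = 0" if "n \<ge> N" for n
      proof -
        have "real N * \<bar>f x\<bar> \<le> real n * \<bar>f x\<bar>"
          using that by (intro mult_right_mono) auto
        with N x show ?thesis
          by (auto simp: g_def max_def)
      qed
      then have "\<forall>\<^sub>F n in sequentially. g n x = 0"
        unfolding eventually_sequentially by blast
      then show ?thesis
        using x False f by (simp add: tendsto_eventually)
    qed (use x f in \<open>simp add: g_def\<close>)
  qed (rule restrict_extensional)
next
  case Empty
  show ?case
    using baire_functions_const[of 0 X]
    by (rule back_subst[of "\<lambda>h. h \<in> baire_functions X"]) auto
next
  case (Compl T)
  have "(\<lambda>x\<in>topspace X. 1 - indicat_real T x) \<in> baire_functions X"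
    by (intro baire_functions_restrict_compose2[OF _ baire_functions_const Compl.IH]
        continuous_intros)
  moreover have "(\<lambda>x\<in>topspace X. 1 - indicat_real T x)
      = (\<lambda>x\<in>topspace X. indicat_real (topspace X - T) x)"
    by (auto simp: fun_eq_iff indicator_def)
  ultimately show ?case
    by metis
next
  case (Union T)
  have fin: "(\<lambda>x\<in>topspace X. indicat_real (\<Union>i<n. T i) x) \<in> baire_functions X" for n
  proof (induction n)
    case 0
    show ?case
      using baire_functions_const[of 0 X]
      by (rule back_subst[of "\<lambda>h. h \<in> baire_functions X"]) auto
  next
    case (Suc n)
    have "(\<lambda>x\<in>topspace X. max (indicat_real (\<Union>i<n. T i) x) (indicat_real (T n) x))
        \<in> baire_functions X"
      by (intro baire_functions_restrict_compose2[OF _ Suc Union.IH] continuous_intros)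
    moreover have "(\<lambda>x\<in>topspace X. max (indicat_real (\<Union>i<n. T i) x) (indicat_real (T n) x))
        = (\<lambda>x\<in>topspace X. indicat_real (\<Union>i<Suc n. T i) x)"
      by (auto simp: fun_eq_iff indicator_def max_def less_Suc_eq)
    ultimately show ?case
      by metis
  qed
  then show ?case
  proof (rule baire_functions.pointwise_limit)
    fix x assume "x \<in> topspace X"
    then show "(\<lambda>n. (\<lambda>x\<in>topspace X. indicat_real (\<Union>i<n. T i) x) x)
        \<longlonglongrightarrow> (\<lambda>x\<in>topspace X. indicat_real (\<Union>i. T i) x) x"
      using LIMSEQ_indicator_UN[of T x] by simp
  qed (rule restrict_extensional)
qed

text \<open>The Lebesgue--Hausdorff description of Baire functions: it turns every question about
  their stability into one about measurability.\<close>

lemma baire_functions_eq: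
  "baire_functions X = extensional (topspace X) \<inter> borel_measurable (baire_algebra X)"
proof
  show "baire_functions X \<subseteq> extensional (topspace X) \<inter> borel_measurable (baire_algebra X)"
    using baire_function_extensional baire_function_measurable by blast
  have nonneg: "restrict u (topspace X) \<in> baire_functions X"
    if "u \<in> borel_measurable (baire_algebra X)" "\<And>x. 0 \<le> u x" for u
    using that
  proof (induction rule: borel_measurable_induct_real)
    case (set T)
    then show ?case
      using baire_functions_indicator[of T X] unfolding sets_baire_algebra by blast
  next
    case (mult u c)
    show ?case
      by (intro baire_functions_restrict_compose2[OF _ baire_functions_const mult.IH]
          continuous_intros)
  next
    case (add u v)
    show ?case
      by (intro baire_functions_restrict_compose2[OF _ add.IH(2) add.IH(1)] continuous_intros)
  next
    case (seq U)
    show ?case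
    proof (rule baire_functions.pointwise_limit[OF _ restrict_extensional])
      show "restrict (U i) (topspace X) \<in> baire_functions X" for i
        by (rule seq.IH)
    qed (use seq in simp)
  qed
  show "extensional (topspace X) \<inter> borel_measurable (baire_algebra X) \<subseteq> baire_functions X"
  proof safe
    fix f :: "_ \<Rightarrow> real"
    assume f: "f \<in> extensional (topspace X)" "f \<in> borel_measurable (baire_algebra X)"
    have "(\<lambda>x\<in>topspace X. max 0 (f x) - max 0 (- f x)) \<in> baire_functions X"
      using f(2)
      by (intro baire_functions_restrict_compose2[where F = "\<lambda>s t. s - t"] nonneg continuous_intros)
        auto
    moreover have "(\<lambda>x\<in>topspace X. max 0 (f x) - max 0 (- f x)) = f"
      using f(1) by (auto simp: fun_eq_iff extensional_def max_def)
    ultimately show "f \<in> baire_functions X"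
      by simp
  qed
qed

section \<open>The topology of pointwise convergence\<close>

lemma topspace_baire_function_space [simp]:
  "topspace (baire_function_space X) = baire_functions X"
  using baire_function_extensional
  by (auto simp: baire_function_space_def PiE_def)

lemma limitin_baire_function_space:
  "limitin (baire_function_space X) s f sequentially \<longleftrightarrow>
    f \<in> baire_functions X \<and> (\<forall>\<^sub>F n in sequentially. s n \<in> baire_functions X) \<and>
    (\<forall>x\<in>topspace X. (\<lambda>n. s n x) \<longlonglongrightarrow> f x)"
proof -
  have "\<forall>\<^sub>F n in sequentially. s n \<in> extensional (topspace X)"
    if "\<forall>\<^sub>F n in sequentially. s n \<in> baire_functions X"
    using that by eventually_elim (rule baire_function_extensional)
  then show ?thesis
    using baire_function_extensional
    by (auto simp: baire_function_space_def limitin_subtopology limitin_componentwise PiE_def)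
qed

definition pointwise_nbhd :: "'a topology \<Rightarrow> ('a \<Rightarrow> real) \<Rightarrow> 'a set \<Rightarrow> real \<Rightarrow> ('a \<Rightarrow> real) set" where
  "pointwise_nbhd X f K \<epsilon> = {g \<in> baire_functions X. \<forall>x\<in>K. \<bar>g x - f x\<bar> < \<epsilon>}"

lemma openin_pointwise_nbhd:
  assumes "finite K" "K \<subseteq> topspace X"
  shows "openin (baire_function_space X) (pointwise_nbhd X f K \<epsilon>)"
proof -
  define W where "W = (\<Pi>\<^sub>E x\<in>topspace X. if x \<in> K then ball (f x) \<epsilon> else UNIV)"
  have "finite {x \<in> topspace X. (if x \<in> K then ball (f x) \<epsilon> else UNIV) \<noteq> UNIV}"
    by (rule finite_subset[OF _ assms(1)]) auto
  then have "openin (powertop_real (topspace X)) W"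
    unfolding W_def by (auto simp: openin_PiE_gen)
  moreover have "pointwise_nbhd X f K \<epsilon> = W \<inter> baire_functions X"
  proof
    show "pointwise_nbhd X f K \<epsilon> \<subseteq> W \<inter> baire_functions X"
      using baire_function_extensional
      by (auto simp: W_def pointwise_nbhd_def PiE_def dist_real_def abs_minus_commute)
    show "W \<inter> baire_functions X \<subseteq> pointwise_nbhd X f K \<epsilon>"
    proof safe
      fix g assume g: "g \<in> W" "g \<in> baire_functions X"
      have "\<bar>g x - f x\<bar> < \<epsilon>" if "x \<in> K" for x
      proof -
        have "x \<in> topspace X" using that assms(2) by auto
        with g(1) have "g x \<in> (if x \<in> K then ball (f x) \<epsilon> else UNIV)"
          unfolding W_def by (rule PiE_mem)
        with that show ?thesis
          by (simp add: dist_real_def abs_minus_commute)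
      qed
      with g(2) show "g \<in> pointwise_nbhd X f K \<epsilon>"
        by (simp add: pointwise_nbhd_def)
    qed
  qed
  ultimately show ?thesis
    by (auto simp: baire_function_space_def openin_subtopology)
qed

lemma pointwise_nbhd_base:
  assumes "openin (baire_function_space X) U" "f \<in> U"
  obtains K \<epsilon> where "finite K" "K \<subseteq> topspace X" "\<epsilon> > 0" "pointwise_nbhd X f K \<epsilon> \<subseteq> U"
proof -
  obtain W where W: "openin (powertop_real (topspace X)) W" "U = W \<inter> baire_functions X"
    using assms(1) by (auto simp: baire_function_space_def openin_subtopology)
  then obtain V where V: "finite {x \<in> topspace X. V x \<noteq> (UNIV :: real set)}"
      "\<And>x. x \<in> topspace X \<Longrightarrow> open (V x)" "f \<in> Pi\<^sub>E (topspace X) V" "Pi\<^sub>E (topspace X) V \<subseteq> W"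
    using assms(2) unfolding openin_product_topology_alt
    by (smt (verit, ccfv_SIG) IntE Collect_cong open_openin topspace_euclidean)
  define K where "K = {x \<in> topspace X. V x \<noteq> UNIV}"
  have "\<exists>\<delta>>0. ball (f x) \<delta> \<subseteq> V x" if "x \<in> topspace X" for x
    using V(2,3) that by (meson PiE_mem open_contains_ball)
  then obtain \<delta> where \<delta>: "\<And>x. x \<in> topspace X \<Longrightarrow> \<delta> x > 0 \<and> ball (f x) (\<delta> x) \<subseteq> V x"
    by metis
  define \<epsilon> where "\<epsilon> = Min (insert 1 (\<delta> ` K))"
  have K: "finite K" "K \<subseteq> topspace X"
    using V(1) by (auto simp: K_def)
  have \<epsilon>: "\<epsilon> > 0" "\<And>x. x \<in> K \<Longrightarrow> \<epsilon> \<le> \<delta> x"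
    using K \<delta> unfolding \<epsilon>_def by (auto simp: subset_iff)
  have "pointwise_nbhd X f K \<epsilon> \<subseteq> U"
  proof
    fix g assume g: "g \<in> pointwise_nbhd X f K \<epsilon>"
    have "g x \<in> V x" if x: "x \<in> topspace X" for x
    proof (cases "x \<in> K")
      case True
      with g \<epsilon>(2)[OF True] have "g x \<in> ball (f x) (\<delta> x)"
        by (auto simp: pointwise_nbhd_def dist_real_def abs_minus_commute intro: less_le_trans)
      with \<delta>[OF x] show ?thesis by auto
    qed (use x in \<open>auto simp: K_def\<close>)
    then have "g \<in> Pi\<^sub>E (topspace X) V"
      using g baire_function_extensional by (auto simp: pointwise_nbhd_def PiE_def)
    with V(4) g W(2) show "g \<in> U"
      by (auto simp: pointwise_nbhd_def)
  qed
  with K \<epsilon>(1) that show ?thesis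
    by blast
qed

lemma in_closure_baire_function_space:
  assumes "A \<subseteq> baire_functions X"
  shows "f \<in> baire_function_space X closure_of A \<longleftrightarrow>
    f \<in> baire_functions X \<and>
    (\<forall>K \<epsilon>. finite K \<and> K \<subseteq> topspace X \<and> \<epsilon> > 0 \<longrightarrow> (\<exists>g\<in>A. \<forall>x\<in>K. \<bar>g x - f x\<bar> < \<epsilon>))"
    (is "_ \<longleftrightarrow> _ \<and> ?approx")
proof (intro iffI conjI)
  assume cl: "f \<in> baire_function_space X closure_of A"
  then show f: "f \<in> baire_functions X"
    by (simp add: in_closure_of)
  show ?approx
  proof (intro allI impI)
    fix K and \<epsilon> :: real assume K: "finite K \<and> K \<subseteq> topspace X \<and> \<epsilon> > 0"
    then have "f \<in> pointwise_nbhd X f K \<epsilon>"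
      using f by (simp add: pointwise_nbhd_def)
    moreover have "openin (baire_function_space X) (pointwise_nbhd X f K \<epsilon>)"
      using K openin_pointwise_nbhd by blast
    ultimately obtain g where "g \<in> A" "g \<in> pointwise_nbhd X f K \<epsilon>"
      using cl unfolding in_closure_of by blast
    then show "\<exists>g\<in>A. \<forall>x\<in>K. \<bar>g x - f x\<bar> < \<epsilon>"
      by (auto simp: pointwise_nbhd_def)
  qed
next
  assume R: "f \<in> baire_functions X \<and> ?approx"
  show "f \<in> baire_function_space X closure_of A"
    unfolding in_closure_of
  proof (intro conjI allI impI)
    fix U assume "f \<in> U \<and> openin (baire_function_space X) U"
    then obtain K \<epsilon> where K: "finite K" "K \<subseteq> topspace X" "\<epsilon> > 0" "pointwise_nbhd X f K \<epsilon> \<subseteq> U"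
      using pointwise_nbhd_base by metis
    then obtain g where "g \<in> A" "\<forall>x\<in>K. \<bar>g x - f x\<bar> < \<epsilon>"
      using R by blast
    then show "\<exists>g. g \<in> A \<and> g \<in> U"
      using K(4) assms by (auto simp: pointwise_nbhd_def)
  qed (use R in simp)
qed

section \<open>Sequential separability and the O-property\<close>

lemma pointwise_sequence_in_seq_dense:
  assumes "sequentially_dense_in (baire_function_space X) D" "f \<in> baire_functions X"
  shows "\<exists>s::nat \<Rightarrow> _. (\<forall>n. s n \<in> D) \<and> (\<forall>x\<in>topspace X. (\<lambda>n. s n x) \<longlonglongrightarrow> f x)"
proof -
  obtain s :: "nat \<Rightarrow> _" where "range s \<subseteq> D" "limitin (baire_function_space X) s f sequentially"
    using assms unfolding sequentially_dense_in_def by auto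
  then show ?thesis
    unfolding limitin_baire_function_space by (intro exI[of _ s]) auto
qed

lemma sequentially_dense_inI:
  assumes "D \<subseteq> baire_functions X"
    and "\<And>f. f \<in> baire_functions X \<Longrightarrow>
      \<exists>s::nat \<Rightarrow> _. (\<forall>n. s n \<in> D) \<and> (\<forall>x\<in>topspace X. (\<lambda>n. s n x) \<longlonglongrightarrow> f x)"
  shows "sequentially_dense_in (baire_function_space X) D"
  unfolding sequentially_dense_in_def limitin_baire_function_space topspace_baire_function_space
proof (intro conjI ballI)
  fix f assume f: "f \<in> baire_functions X"
  then obtain s where s: "\<And>n::nat. s n \<in> D" "\<forall>x\<in>topspace X. (\<lambda>n. s n x) \<longlonglongrightarrow> f x"
    using assms(2) by blast
  from s(1) assms(1) have "\<forall>\<^sub>F n in sequentially. s n \<in> baire_functions X"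
    by (intro always_eventually) blast
  with s f show "\<exists>s::nat \<Rightarrow> _. range s \<subseteq> D \<and> f \<in> baire_functions X \<and>
      (\<forall>\<^sub>F n in sequentially. s n \<in> baire_functions X) \<and>
      (\<forall>x\<in>topspace X. (\<lambda>n. s n x) \<longlonglongrightarrow> f x)"
    by (intro exI[of _ s]) blast
qed (rule assms(1))

lemma seq_dense_nonempty:
  assumes "sequentially_dense_in (baire_function_space X) D"
  shows "D \<noteq> {}"
proof
  assume "D = {}"
  then show False
    using pointwise_sequence_in_seq_dense[OF assms baire_functions_const[of 0]] by simp
qed

text \<open>A sequentially dense set approximates in particular the continuous functions, and these
  separate the points of a Tychonoff space.\<close>

lemma seq_dense_separates_points:
  assumes X: "completely_regular_space X" "Hausdorff_space X"
    and D: "sequentially_dense_in (baire_function_space X) D"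
    and x: "x \<in> topspace X" and y: "y \<in> topspace X" and "x \<noteq> y"
  obtains d where "d \<in> D" "d x \<noteq> d y"
proof -
  have "closedin X {y}"
    using X(2) y by (simp add: closedin_Hausdorff_singleton)
  moreover have "x \<in> topspace X - {y}"
    using x \<open>x \<noteq> y\<close> by simp
  ultimately obtain f where "continuous_map X (top_of_set {0..1::real}) f \<and>
      f x = 0 \<and> f ` {y} \<subseteq> {1}"
    using X(1) unfolding completely_regular_space_def by presburger
  then have f: "continuous_map X (top_of_set {0..1::real}) f" "f x = 0" "f y = 1"
    by auto
  then have "continuous_map X euclideanreal f"
    by (simp add: continuous_map_in_subtopology)
  then have "continuous_map X euclideanreal (restrict f (topspace X))"
    by (rule continuous_map_eq) auto
  with restrict_extensional have "restrict f (topspace X) \<in> baire_functions X"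
    by (rule baire_functions.continuous)
  from pointwise_sequence_in_seq_dense[OF D this]
  obtain s :: "nat \<Rightarrow> _" where "(\<forall>n. s n \<in> D) \<and>
      (\<forall>z\<in>topspace X. (\<lambda>n. s n z) \<longlonglongrightarrow> restrict f (topspace X) z)" ..
  then have s: "\<And>n. s n \<in> D"
      "\<And>z. z \<in> topspace X \<Longrightarrow> (\<lambda>n. s n z) \<longlonglongrightarrow> restrict f (topspace X) z"
    by blast+
  have "\<exists>n. s n x \<noteq> s n y"
  proof (rule ccontr)
    assume "\<nexists>n. s n x \<noteq> s n y"
    then have "restrict f (topspace X) x = restrict f (topspace X) y"
      using s(2)[OF x] s(2)[OF y] LIMSEQ_unique by auto
    with f x y show False by simp
  qed
  with s(1) that show ?thesis by blast
qed

text \<open>Evaluation at the functions of a countable sequentially dense set embeds the points into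
  \<open>\<real>\<^sup>\<omega>\<close>. A Baire set is \<open>F\<^sub>\<sigma>\<close> for the topology induced in this way, because its characteristic
  function is the limit of a sequence of coordinate functions.\<close>

lemma sequentially_separable_imp_O_property:
  assumes X: "completely_regular_space X" "Hausdorff_space X"
    and sep: "sequentially_separable (baire_function_space X)"
  shows "O_property X"
proof -
  obtain D where D: "countable D" "sequentially_dense_in (baire_function_space X) D"
    using sep by (auto simp: sequentially_separable_def)
  define d where "d = from_nat_into D"
  have d: "range d = D"
    using D(1) seq_dense_nonempty[OF D(2)] by (simp add: d_def range_from_nat_into)
  then have d_baire: "d k \<in> baire_functions X" for k
    using D by (auto simp: sequentially_dense_in_def)
  define E where "E x = (\<lambda>k. d k x)" for x
  have inj: "inj_on E (topspace X)"
  proof (rule inj_onI, rule ccontr)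
    fix x y assume *: "x \<in> topspace X" "y \<in> topspace X" "E x = E y" "x \<noteq> y"
    then obtain k where "d k x \<noteq> d k y"
      using seq_dense_separates_points[OF X D(2), of x y] d by blast
    with * show False
      by (auto simp: E_def fun_eq_iff)
  qed
  have E_meas: "E \<in> borel_measurable (baire_algebra X)"
    by (intro measurable_coordinatewise_then_product)
      (simp add: E_def baire_function_measurable[OF d_baire])
  define Y where "Y = pullback_topology (topspace X) E euclidean"
  have topY: "topspace Y = topspace X"
    by (simp add: Y_def topspace_pullback_topology)
  have openY: "openin Y U \<longleftrightarrow> (\<exists>V. open V \<and> U = E -` V \<inter> topspace X)" for U
    by (simp add: Y_def openin_pullback_topology)
  have "embedding_map Y euclidean E"
    unfolding embedding_map_def
  proof (rule bijective_open_imp_homeomorphic_map)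
    show "continuous_map Y (top_of_set (E ` topspace Y)) E"
    proof -
      have "continuous_map Y euclidean E"
        by (auto simp: continuous_map_def openY topY)
      then show ?thesis
        by (simp add: continuous_map_in_subtopology)
    qed
    show "open_map Y (top_of_set (E ` topspace Y)) E"
      unfolding open_map_def
    proof (intro allI impI)
      fix U assume "openin Y U"
      then obtain V where "open V" "U = E -` V \<inter> topspace X"
        by (auto simp: openY)
      moreover from this have "E ` U = E ` topspace Y \<inter> V"
        using topY by auto
      ultimately show "openin (top_of_set (E ` topspace Y)) (E ` U)"
        by (auto simp: openin_open)
    qed
  qed (use inj topY in auto)
  then have hom: "Y homeomorphic_space top_of_set (E ` topspace Y)"
    by (auto simp: embedding_map_def homeomorphic_map_imp_homeomorphic_space)
  have "metrizable_space (top_of_set (E ` topspace Y))"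
    by (intro metrizable_space_subtopology metrizable_space_euclidean)
  then have metr: "metrizable_space Y"
    using hom homeomorphic_metrizable_space by blast
  obtain B where B: "countable B" "\<And>b::(nat \<Rightarrow> real) set. b \<in> B \<Longrightarrow> open b"
      "\<And>S. open S \<Longrightarrow> \<exists>U. U \<subseteq> B \<and> S = \<Union>U"
    using univ_second_countable by metis
  have "\<exists>V\<in>B. x \<in> V \<and> V \<subseteq> S" if "open S" "x \<in> S" for x S
    using B(3)[OF that(1)] that(2) by blast
  with B have "second_countable (euclidean :: (nat \<Rightarrow> real) topology)"
    unfolding second_countable_def by (intro exI[of _ B]) auto
  then have "separable_space (top_of_set (E ` topspace Y))"
    using second_countable_subtopology second_countable_imp_separable_space by blast
  then have sepY: "separable_space Y"
    using hom homeomorphic_separable_space by blast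
  have "{x \<in> topspace X. x \<in> U} \<in> baire_sets X" if U: "openin Y U" for U
  proof -
    obtain V where V: "open V" "U = E -` V \<inter> topspace X"
      using U by (auto simp: openY)
    then have "E -` V \<inter> space (baire_algebra X) \<in> sets (baire_algebra X)"
      using E_meas by (intro measurable_sets[of E _ borel]) auto
    with V show ?thesis
      by (metis Collect_conj_eq Collect_mem_eq Int_left_absorb inf_commute sets_baire_algebra space_baire_algebra)
  qed
  moreover have "fsigma_in Y T" if T: "T \<in> baire_sets X" for T
  proof -
    obtain s :: "nat \<Rightarrow> _" where "(\<forall>n. s n \<in> D) \<and>
        (\<forall>x\<in>topspace X. (\<lambda>n. s n x) \<longlonglongrightarrow> (\<lambda>x\<in>topspace X. indicat_real T x) x)"
      using pointwise_sequence_in_seq_dense[OF D(2) baire_functions_indicator[OF T]] ..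
    then have s: "\<And>n. s n \<in> D"
        "\<And>x. x \<in> topspace X \<Longrightarrow> (\<lambda>n. s n x) \<longlonglongrightarrow> (\<lambda>x\<in>topspace X. indicat_real T x) x"
      by blast+
    obtain \<kappa> where \<kappa>: "\<And>n. s n = d (\<kappa> n)"
    proof -
      have "\<forall>n. \<exists>k. s n = d k"
        using s(1) unfolding d[symmetric] by blast
      then show ?thesis
        using that by metis
    qed
    \<comment> \<open>The limit is \<open>0\<close> or \<open>1\<close>, so it is \<open>1\<close> exactly if the sequence finally stays above \<open>1/2\<close>.\<close>
    define C where "C N = {x \<in> topspace X. \<forall>n\<ge>N. s n x \<ge> 1/2}" for N
    have "closedin Y (C N)" for N
    proof -
      have "open (- {y::nat \<Rightarrow> real. \<forall>n\<ge>N. y (\<kappa> n) \<ge> 1/2})"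
      proof -
        have "closed {y::nat \<Rightarrow> real. \<forall>n\<ge>N. y (\<kappa> n) \<ge> 1/2}"
          by (intro closed_Collect_all closed_Collect_imp closed_Collect_le continuous_intros
              continuous_on_product_coordinates) auto
        then show ?thesis by (simp add: open_closed)
      qed
      moreover have "topspace Y - C N
          = E -` (- {y::nat \<Rightarrow> real. \<forall>n\<ge>N. y (\<kappa> n) \<ge> 1/2}) \<inter> topspace X"
        by (auto simp: topY C_def E_def \<kappa>)
      ultimately show ?thesis
        unfolding closedin_def by (auto simp: openY C_def topY)
    qed
    moreover have "T = (\<Union>N. C N)"
    proof
      show "T \<subseteq> (\<Union>N. C N)"
      proof
        fix x assume x: "x \<in> T"
        then have xX: "x \<in> topspace X" using baire_sets_subset[OF T] by auto
        then have "(\<lambda>n. s n x) \<longlonglongrightarrow> 1" using s(2)[OF xX] x by simp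
        then have "\<forall>\<^sub>F n in sequentially. s n x > 1/2"
          by (rule order_tendstoD) simp
        then show "x \<in> (\<Union>N. C N)"
          using xX by (auto simp: eventually_sequentially C_def intro: less_imp_le)
      qed
      show "(\<Union>N. C N) \<subseteq> T"
      proof safe
        fix x N assume x: "x \<in> C N"
        then have xX: "x \<in> topspace X" by (simp add: C_def)
        have "1/2 \<le> indicat_real T x"
          using s(2)[OF xX] xX x by (intro LIMSEQ_le_const[of "\<lambda>n. s n x"]) (auto simp: C_def)
        then show "x \<in> T" by (cases "x \<in> T") auto
      qed
    qed
    moreover have "fsigma_in Y (\<Union>(range C))"
      using \<open>\<And>N. closedin Y (C N)\<close> by (intro fsigma_in_Union) (auto intro: closed_imp_fsigma_in)
    ultimately show ?thesis
      by simp
  qed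
  ultimately show ?thesis
    unfolding O_property_def using metr sepY topY
    by (intro exI[of _ Y] exI[of _ "\<lambda>x. x"]) (auto simp: bij_betw_def)
qed

lemma separable_metrizable_imp_second_countable:
  assumes "separable_space Y" "metrizable_space Y"
  shows "second_countable Y"
proof -
  obtain M d where M: "Metric_space M d" and Y: "Y = Metric_space.mtopology M d"
    using assms(2) by (auto simp: metrizable_space_def)
  interpret Metric_space M d by (rule M)
  obtain C where C: "countable C" "C \<subseteq> M" "mtopology closure_of C = M"
    using assms(1) by (auto simp: separable_space_def Y)
  define \<B> where "\<B> = (\<lambda>(c, n). mball c (inverse (Suc n))) ` (C \<times> (UNIV :: nat set))"
  have "countable \<B>"
    using C(1) by (simp add: \<B>_def)
  moreover have "\<forall>V\<in>\<B>. openin mtopology V"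
    by (auto simp: \<B>_def)
  moreover have "\<exists>V\<in>\<B>. x \<in> V \<and> V \<subseteq> U" if U: "openin mtopology U" "x \<in> U" for U x
  proof -
    obtain r where r: "r > 0" "mball x r \<subseteq> U"
      using U by (auto simp: openin_mtopology)
    obtain n where n: "inverse (Suc n) < r / 2"
      using reals_Archimedean[of "r/2"] r by auto
    have x: "x \<in> M"
      using U openin_subset by fastforce
    then have "x \<in> mtopology closure_of C" using C by simp
    moreover have "openin mtopology (mball x (inverse (Suc n)))" "x \<in> mball x (inverse (Suc n))"
      using x by auto
    ultimately obtain c where c: "c \<in> C" "c \<in> mball x (inverse (Suc n))"
      unfolding in_closure_of by blast
    have "mball c (inverse (Suc n)) \<subseteq> mball x r"
    proof
      fix z assume z: "z \<in> mball c (inverse (Suc n))"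
      then have "d x z \<le> d x c + d c z"
        using c x by (intro triangle) auto
      with z c n x show "z \<in> mball x r" by (auto simp del: of_nat_Suc)
    qed
    moreover have "x \<in> mball c (inverse (Suc n))"
      using c by (auto simp: commute)
    ultimately show ?thesis
      using c(1) r(2) unfolding \<B>_def by blast
  qed
  ultimately show ?thesis
    unfolding second_countable_def Y by (intro exI[of _ \<B>]) simp
qed

text \<open>What the separable metrizable topology contributes, transported to the points of \<open>X\<close>:
  a sequence of Baire sets \<open>U j\<close>, its base, such that each Baire set is a countable union of
  sets \<open>C\<close> that are closed in the sense that a point outside \<open>C\<close> lies in some \<open>U j\<close> that
  misses \<open>C\<close>.\<close>

lemma O_property_countable_base:
  assumes "O_property X"
  obtains U :: "nat \<Rightarrow> 'a set" where "\<And>j. U j \<in> baire_sets X"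
    "\<And>T. T \<in> baire_sets (X :: 'a topology) \<Longrightarrow> \<exists>C::nat \<Rightarrow> 'a set. T = (\<Union>i. C i) \<and>
      (\<forall>i. \<forall>x\<in>topspace X - C i. \<exists>j. x \<in> U j \<and> U j \<inter> C i = {})"
proof -
  let ?witness = "\<lambda>(Y :: 'a topology) \<phi>. separable_space Y \<and> metrizable_space Y \<and>
      bij_betw \<phi> (topspace X) (topspace Y) \<and>
      (\<forall>U. openin Y U \<longrightarrow> {x \<in> topspace X. \<phi> x \<in> U} \<in> baire_sets X) \<and>
      (\<forall>T \<in> baire_sets X. fsigma_in Y (\<phi> ` T))"
  have "\<exists>Y \<phi>. ?witness Y \<phi>"
    using assms by (simp only: O_property_def)
  then obtain Y where "\<exists>\<phi>. ?witness Y \<phi>" ..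
  then obtain \<phi> where "?witness Y \<phi>" ..
  then have Y: "separable_space Y" "metrizable_space Y"
    and bij: "bij_betw \<phi> (topspace X) (topspace Y)"
    and meas: "\<And>U. openin Y U \<Longrightarrow> {x \<in> topspace X. \<phi> x \<in> U} \<in> baire_sets X"
    and fsigma: "\<And>T. T \<in> baire_sets X \<Longrightarrow> fsigma_in Y (\<phi> ` T)"
    by blast+
  obtain \<B> where "countable \<B> \<and> (\<forall>V\<in>\<B>. openin Y V) \<and>
      (\<forall>U x. openin Y U \<and> x \<in> U \<longrightarrow> (\<exists>V\<in>\<B>. x \<in> V \<and> V \<subseteq> U))"
    using separable_metrizable_imp_second_countable[OF Y] unfolding second_countable_def ..
  then have \<B>: "countable \<B>" "\<And>V. V \<in> \<B> \<Longrightarrow> openin Y V"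
      "\<And>U x. openin Y U \<Longrightarrow> x \<in> U \<Longrightarrow> \<exists>V\<in>\<B>. x \<in> V \<and> V \<subseteq> U"
    by simp_all
  \<comment> \<open>The empty set keeps the enumeration meaningful if \<open>\<B>\<close> is empty.\<close>
  define W where "W = from_nat_into (insert {} \<B>)"
  have W: "range W = insert {} \<B>"
    using \<B>(1) by (simp add: W_def range_from_nat_into)
  then have openW: "openin Y (W j)" for j
    using \<B>(2) by (metis insertE openin_empty rangeI)
  define U where "U j = {x \<in> topspace X. \<phi> x \<in> W j}" for j
  have 1: "U j \<in> baire_sets X" for j
    using meas openW by (simp add: U_def)
  have 2: "\<exists>C::nat \<Rightarrow> 'a set. T = (\<Union>i. C i) \<and>
      (\<forall>i. \<forall>x\<in>topspace X - C i. \<exists>j. x \<in> U j \<and> U j \<inter> C i = {})" if T: "T \<in> baire_sets X" for T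
  proof -
    obtain F :: "nat \<Rightarrow> 'a set" where F: "\<And>i. closedin Y (F i)" "(\<Union>i. F i) = \<phi> ` T"
      using fsigma[OF T] by (auto simp: fsigma_in_ascending)
    define C where "C i = {x \<in> topspace X. \<phi> x \<in> F i}" for i
    have "T = (\<Union>i. C i)"
    proof -
      have "x \<in> T \<longleftrightarrow> \<phi> x \<in> \<phi> ` T" if "x \<in> topspace X" for x
        using bij baire_sets_subset[OF T] that
        by (meson bij_betw_imp_inj_on image_eqI inj_on_image_mem_iff)
      then show ?thesis
        using F(2) baire_sets_subset[OF T] unfolding C_def by blast
    qed
    moreover have "\<exists>j. x \<in> U j \<and> U j \<inter> C i = {}" if x: "x \<in> topspace X - C i" for x i
    proof -
      have "\<phi> x \<in> topspace Y - F i"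
        using x bij by (auto simp: C_def bij_betw_def)
      moreover have "openin Y (topspace Y - F i)"
        using F(1) by auto
      ultimately obtain V where "V \<in> \<B>" "\<phi> x \<in> V" "V \<subseteq> topspace Y - F i"
        using \<B>(3) by blast
      moreover obtain j where "V = W j"
        using W \<open>V \<in> \<B>\<close> by blast
      ultimately show ?thesis
        using x by (intro exI[of _ j]) (auto simp: U_def C_def)
    qed
    ultimately show ?thesis by blast
  qed
  show ?thesis
    by (rule that[OF 1 2])
qed

section \<open>A countable sequentially dense set of Baire functions\<close>

definition trace_upto :: "(nat \<Rightarrow> 'a set) \<Rightarrow> nat \<Rightarrow> 'a \<Rightarrow> nat set" where
  "trace_upto U m x = {j. j < m \<and> x \<in> U j}"

text \<open>The functions that take rational values and read off their value at \<open>x\<close> from the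
  membership of \<open>x\<close> in finitely many of the \<open>U j\<close>. They form the countable sequentially dense
  set that the O-property provides.\<close>

definition trace_functions :: "'a topology \<Rightarrow> (nat \<Rightarrow> 'a set) \<Rightarrow> ('a \<Rightarrow> real) set" where
  "trace_functions X U = {\<lambda>x\<in>topspace X. G (trace_upto U m x) | m G. range G \<subseteq> \<rat>}"

lemma trace_upto_subset: "trace_upto U m x \<in> Pow {..<m}"
  by (auto simp: trace_upto_def)

text \<open>The function \<open>G\<close> matters only on the finitely many subsets of \<open>{..<m}\<close>.\<close>

lemma countable_trace_functions: "countable (trace_functions X U)"
proof -
  have "countable (\<Union>m. (\<lambda>G. \<lambda>x\<in>topspace X. G (trace_upto U m x)) ` (Pow {..<m} \<rightarrow>\<^sub>E (\<rat> :: real set)))"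
    by (intro countable_UN countable_image countable_PiE countable_rat) auto
  moreover have "trace_functions X U
      \<subseteq> (\<Union>m. (\<lambda>G. \<lambda>x\<in>topspace X. G (trace_upto U m x)) ` (Pow {..<m} \<rightarrow>\<^sub>E (\<rat> :: real set)))"
  proof
    fix f assume "f \<in> trace_functions X U"
    then obtain m G where G: "f = (\<lambda>x\<in>topspace X. G (trace_upto U m x))" "range G \<subseteq> \<rat>"
      by (auto simp: trace_functions_def)
    have "f = (\<lambda>x\<in>topspace X. restrict G (Pow {..<m}) (trace_upto U m x))"
      using G(1) trace_upto_subset[of U m] by (simp add: fun_eq_iff)
    moreover have "restrict G (Pow {..<m}) \<in> Pow {..<m} \<rightarrow>\<^sub>E \<rat>"
      using G(2) by auto
    ultimately show "f \<in> (\<Union>m. (\<lambda>G. \<lambda>x\<in>topspace X. G (trace_upto U m x)) ` (Pow {..<m} \<rightarrow>\<^sub>E \<rat>))"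
      by blast
  qed
  ultimately show ?thesis
    by (rule countable_subset[rotated])
qed

lemma trace_functions_subset_baire_functions:
  assumes "\<And>j. U j \<in> baire_sets X"
  shows "trace_functions X U \<subseteq> baire_functions X"
proof
  fix f assume "f \<in> trace_functions X U"
  then obtain m G where f: "f = (\<lambda>x\<in>topspace X. G (trace_upto U m x))"
    by (auto simp: trace_functions_def)
  have U: "U j \<in> sets (baire_algebra X)" for j
    using assms by simp
  have "trace_upto U m \<in> baire_algebra X \<rightarrow>\<^sub>M count_space (Pow {..<m})"
  proof (subst measurable_count_space_eq2)
    show "trace_upto U m \<in> space (baire_algebra X) \<rightarrow> Pow {..<m} \<and>
      (\<forall>t\<in>Pow {..<m}. trace_upto U m -` {t} \<inter> space (baire_algebra X) \<in> sets (baire_algebra X))"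
    proof (intro conjI ballI)
      fix t assume t: "t \<in> Pow {..<m}"
      have trace_eq: "trace_upto U m x = t \<longleftrightarrow> (\<forall>j\<in>{..<m}. x \<in> U j \<longleftrightarrow> j \<in> t)" for x
        using t unfolding trace_upto_def set_eq_iff by blast
      have "trace_upto U m -` {t} \<inter> space (baire_algebra X)
          = {x \<in> space (baire_algebra X). \<forall>j\<in>{..<m}. x \<in> U j \<longleftrightarrow> j \<in> t}"
        unfolding vimage_def Int_def by (simp add: trace_eq conj_commute)
      also have "\<dots> \<in> sets (baire_algebra X)"
      proof (intro sets.sets_Collect_finite_All ballI)
        fix j
        have "{x \<in> space (baire_algebra X). x \<in> U j \<longleftrightarrow> j \<in> t}
            = (if j \<in> t then U j \<inter> space (baire_algebra X) else space (baire_algebra X) - U j)"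
          by auto
        then show "{x \<in> space (baire_algebra X). x \<in> U j \<longleftrightarrow> j \<in> t} \<in> sets (baire_algebra X)"
          using U[of j] by (simp del: space_baire_algebra sets_baire_algebra)
      qed simp
      finally show "trace_upto U m -` {t} \<inter> space (baire_algebra X) \<in> sets (baire_algebra X)" .
    qed (use trace_upto_subset[of U m] in \<open>simp add: Pi_iff\<close>)
  qed simp
  then have "(\<lambda>x. G (trace_upto U m x)) \<in> borel_measurable (baire_algebra X)"
    by (rule measurable_compose) simp
  then have "f \<in> borel_measurable (baire_algebra X)"
    by (rule measurable_cong[THEN iffD1, rotated]) (simp add: f)
  moreover have "f \<in> extensional (topspace X)"
    unfolding f by (rule restrict_extensional)
  ultimately show "f \<in> baire_functions X"
    by (simp add: baire_functions_eq)
qed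

text \<open>For a Baire function, the sets on which it is \<open>e\<close>-close to a given rational are Baire sets;
  decomposing each of them gives a countable cover of the space by sets of the distinguished
  kind \<open>P\<close>.\<close>

lemma cover_by_approximating_sets:
  assumes f: "f \<in> baire_functions X" and "e > 0"
    and dec: "\<And>T. T \<in> baire_sets X \<Longrightarrow> \<exists>C::nat \<Rightarrow> 'a set. T = (\<Union>i. C i) \<and> (\<forall>i. P (C i))"
  shows "\<exists>(C :: nat \<Rightarrow> 'a set) q. (\<Union>i. C i) = topspace X \<and> (\<forall>i. P (C i)) \<and> range q \<subseteq> \<rat> \<and>
    (\<forall>i. \<forall>x\<in>C i. \<bar>f x - q i\<bar> < e)"
proof -
  define r :: "nat \<Rightarrow> real" where "r = from_nat_into \<rat>"
  have r: "range r = \<rat>"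
    using countable_rat Rats_0 unfolding r_def by (intro range_from_nat_into) auto
  define T where "T k = {x \<in> topspace X. \<bar>f x - r k\<bar> < e}" for k
  have "T k \<in> baire_sets X" for k
  proof -
    have [measurable]: "f \<in> borel_measurable (baire_algebra X)"
      using f by (rule baire_function_measurable)
    have "{x \<in> space (baire_algebra X). \<bar>f x - r k\<bar> < e} \<in> sets (baire_algebra X)"
      by measurable
    then show ?thesis
      by (simp add: T_def)
  qed
  then have "\<forall>k. \<exists>C::nat \<Rightarrow> 'a set. T k = (\<Union>i. C i) \<and> (\<forall>i. P (C i))"
    using dec by blast
  then obtain C where C: "\<And>k. T k = (\<Union>i. C k i)" "\<And>k i. P (C k (i::nat))"
    by metis
  define C' where "C' i = C (fst (prod_decode i)) (snd (prod_decode i))" for i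
  define q where "q i = r (fst (prod_decode i))" for i
  have "(\<Union>i. C' i) = topspace X"
  proof
    show "(\<Union>i. C' i) \<subseteq> topspace X"
      using C(1) by (auto simp: C'_def T_def)
    show "topspace X \<subseteq> (\<Union>i. C' i)"
    proof
      fix x assume x: "x \<in> topspace X"
      obtain s where s: "s \<in> \<rat>" "f x - e < s" "s < f x + e"
        using Rats_dense_in_real[of "f x - e" "f x + e"] \<open>e > 0\<close> by auto
      then obtain k where k: "s = r k"
        using r by blast
      with s x have "x \<in> T k" by (auto simp: T_def abs_if)
      then obtain i where "x \<in> C k i" using C(1) by auto
      then have "x \<in> C' (prod_encode (k, i))" by (simp add: C'_def)
      then show "x \<in> (\<Union>i. C' i)" by blast
    qed
  qed
  moreover have "\<bar>f x - q i\<bar> < e" if "x \<in> C' i" for x i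
  proof -
    have "x \<in> T (fst (prod_decode i))"
      using that C(1) by (auto simp: C'_def)
    then show ?thesis
      by (simp add: T_def q_def)
  qed
  moreover have "range q \<subseteq> \<rat>"
    using r by (auto simp: q_def)
  moreover have "P (C' i)" for i
    using C(2) by (simp add: C'_def)
  ultimately show ?thesis
    by (intro exI[of _ C'] exI[of _ q]) simp
qed

text \<open>A single sequence of functions that see only finitely many \<open>U j\<close> has to converge to \<open>f\<close>
  at every point; there is no diagonal argument for pointwise convergence. For each precision
  \<open>e n\<close> cover the space by closed sets \<open>C n i\<close> on which \<open>f\<close> is \<open>e n\<close>-close to a rational
  \<open>q n i\<close>. That \<open>x\<close> lies outside a closed set is witnessed by a single \<open>U j\<close>. So, knowing
  only the finite set \<open>t\<close> of those \<open>j < m\<close> with \<open>x \<in> U j\<close>, guess that \<open>x\<close> lies in the first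
  \<open>C n i\<close> that \<open>t\<close> does not exclude. For fixed \<open>n\<close> the guess is right once \<open>m\<close> is large. To
  treat all precisions at once, use the finest precision up to which the guesses contradict
  each other by no more than the errors allow: this precision tends to infinity with \<open>m\<close>, and a
  premature wrong guess at a fine precision does little harm because it is still consistent
  with the right guesses at the coarser ones.\<close>

lemma trace_functions_sequentially_dense:
  fixes X :: "'a topology"
  assumes U: "\<And>j. U j \<in> baire_sets X"
    and dec: "\<And>T. T \<in> baire_sets X \<Longrightarrow> \<exists>C::nat \<Rightarrow> 'a set. T = (\<Union>i. C i) \<and>
      (\<forall>i. \<forall>x\<in>topspace X - C i. \<exists>j. x \<in> U j \<and> U j \<inter> C i = {})"
  shows "sequentially_dense_in (baire_function_space X) (trace_functions X U)"
proof (rule sequentially_dense_inI)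
  show "trace_functions X U \<subseteq> baire_functions X"
    using U by (rule trace_functions_subset_baire_functions)
  fix f assume f: "f \<in> baire_functions X"
  define e :: "nat \<Rightarrow> real" where "e n = inverse (Suc n)" for n
  have e_pos: "e n > 0" for n by (simp add: e_def)
  have e_mono: "e n \<le> e m" if "m \<le> n" for m n
    using that by (simp add: e_def)
  have e_0: "e \<longlonglongrightarrow> 0"
    using LIMSEQ_inverse_real_of_nat by (simp add: e_def [abs_def])
  have "\<forall>n. \<exists>(C :: nat \<Rightarrow> 'a set) q. (\<Union>i. C i) = topspace X \<and>
      (\<forall>i. \<forall>x\<in>topspace X - C i. \<exists>j. x \<in> U j \<and> U j \<inter> C i = {}) \<and> range q \<subseteq> \<rat> \<and>
      (\<forall>i. \<forall>x\<in>C i. \<bar>f x - q i\<bar> < e n)"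
    by (intro allI cover_by_approximating_sets[OF f e_pos, where P =
        "\<lambda>C. \<forall>x\<in>topspace X - C. \<exists>j. x \<in> U j \<and> U j \<inter> C = {}"] dec)
  from choice[OF this] obtain C where "\<forall>n. \<exists>q. (\<Union>i. C n i) = topspace X \<and>
      (\<forall>i. \<forall>x\<in>topspace X - C n i. \<exists>j. x \<in> U j \<and> U j \<inter> C n i = {}) \<and> range q \<subseteq> \<rat> \<and>
      (\<forall>i::nat. \<forall>x\<in>C n i. \<bar>f x - q i\<bar> < e n)" ..
  from choice[OF this] obtain q where "\<forall>n. (\<Union>i. C n i) = topspace X \<and>
      (\<forall>i. \<forall>x\<in>topspace X - C n i. \<exists>j. x \<in> U j \<and> U j \<inter> C n i = {}) \<and> range (q n) \<subseteq> \<rat> \<and>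
      (\<forall>i::nat. \<forall>x\<in>C n i. \<bar>f x - q n i\<bar> < e n)" ..
  note Cq = this
  have C: "(\<Union>i. C n i) = topspace X" for n
    using Cq[rule_format, of n] by (elim conjE)
  have miss: "\<exists>j. x \<in> U j \<and> U j \<inter> C n i = {}" if "x \<in> topspace X" "x \<notin> C n i" for x n i
    using Cq that by simp
  have q: "q n i \<in> \<rat>" for n i
    using Cq by (simp add: image_subset_iff)
  have approx: "\<bar>f x - q n i\<bar> < e n" if "x \<in> C n i" for x n i
    using Cq that by simp
  define guess where "guess n t = q n (LEAST i. t \<inter> {j. U j \<inter> C n i = {}} = {})" for n t
  define consistent where
    "consistent N t \<longleftrightarrow> (\<forall>k\<le>N. \<forall>l\<le>N. \<bar>guess k t - guess l t\<bar> \<le> e k + e l)" for N t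
  define level where "level m t = Max {N. N \<le> m \<and> consistent N t}" for m t
  define G where "G m t = guess (level m t) t" for m t
  have level: "level m t \<le> m" "consistent (level m t) t" "N \<le> m \<Longrightarrow> consistent N t \<Longrightarrow> N \<le> level m t"
    for m t N
  proof -
    have fin: "finite {N. N \<le> m \<and> consistent N t}" by simp
    have "0 \<in> {N. N \<le> m \<and> consistent N t}"
      using e_pos[of 0] by (simp add: consistent_def)
    then have "level m t \<in> {N. N \<le> m \<and> consistent N t}"
      unfolding level_def by (metis (no_types, lifting) Max_in[OF fin] empty_iff)
    then show "level m t \<le> m" "consistent (level m t) t" by auto
    show "N \<le> level m t" if "N \<le> m" "consistent N t"
      using that fin unfolding level_def by (intro Max_ge) auto
  qed
  have guess_eventually: "\<forall>\<^sub>F m in sequentially. \<bar>f x - guess n (trace_upto U m x)\<bar> < e n"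
    if x: "x \<in> topspace X" for n x
  proof -
    define i where "i = (LEAST i. x \<in> C n i)"
    have "x \<in> (\<Union>i. C n i)"
      using x C[of n] by simp
    then have i: "x \<in> C n i"
      unfolding i_def by (metis LeastI UN_E)
    have "\<forall>\<^sub>F m in sequentially. trace_upto U m x \<inter> {j. U j \<inter> C n k = {}} \<noteq> {}" if "k < i" for k
    proof -
      have "x \<notin> C n k"
        using that not_less_Least i_def by blast
      with miss x obtain j where "x \<in> U j" "U j \<inter> C n k = {}" by blast
      then have "j \<in> trace_upto U m x \<inter> {j. U j \<inter> C n k = {}}" if "m > j" for m
        using that by (auto simp: trace_upto_def)
      then show ?thesis
        using eventually_gt_at_top[of j] by (elim eventually_mono) blast
    qed
    then have "\<forall>\<^sub>F m in sequentially. \<forall>k\<in>{..<i}. trace_upto U m x \<inter> {j. U j \<inter> C n k = {}} \<noteq> {}"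
      by (intro eventually_ball_finite) auto
    then show ?thesis
    proof eventually_elim
      case (elim m)
      have "trace_upto U m x \<inter> {j. U j \<inter> C n i = {}} = {}"
        using i by (auto simp: trace_upto_def)
      then have "(LEAST k. trace_upto U m x \<inter> {j. U j \<inter> C n k = {}} = {}) = i"
        using elim by (intro Least_equality) (auto simp: not_le[symmetric])
      then show ?case
        using approx[OF i] by (simp add: guess_def)
    qed
  qed
  have "(\<lambda>m. G m (trace_upto U m x)) \<longlonglongrightarrow> f x" if x: "x \<in> topspace X" for x
  proof (rule tendstoI)
    fix \<epsilon> :: real assume "\<epsilon> > 0"
    then have "\<forall>\<^sub>F n in sequentially. e n < \<epsilon> / 3"
      using e_0 by (intro order_tendstoD) auto
    then obtain n where n: "e n < \<epsilon> / 3"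
      by (auto simp: eventually_sequentially)
    have "\<forall>\<^sub>F m in sequentially. \<forall>k\<in>{..n}. \<bar>f x - guess k (trace_upto U m x)\<bar> < e k"
      using guess_eventually[OF x] by (intro eventually_ball_finite) auto
    then show "\<forall>\<^sub>F m in sequentially. dist (G m (trace_upto U m x)) (f x) < \<epsilon>"
      using eventually_ge_at_top[of n]
    proof eventually_elim
      case (elim m)
      let ?t = "trace_upto U m x"
      have "\<bar>guess k ?t - guess l ?t\<bar> \<le> e k + e l" if "k \<le> n" "l \<le> n" for k l
      proof -
        have "\<bar>f x - guess k ?t\<bar> < e k" "\<bar>f x - guess l ?t\<bar> < e l"
          using elim that by auto
        then show ?thesis by linarith
      qed
      then have "consistent n ?t"
        by (simp add: consistent_def)
      then have N: "n \<le> level m ?t"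
        using level(3) elim by blast
      then have "\<bar>guess (level m ?t) ?t - guess n ?t\<bar> \<le> e (level m ?t) + e n"
        using level(2)[of m ?t] by (auto simp: consistent_def)
      also have "\<dots> \<le> 2 * e n"
        using e_mono[OF N] by simp
      finally have "\<bar>G m ?t - guess n ?t\<bar> \<le> 2 * e n"
        by (simp add: G_def)
      moreover have "\<bar>f x - guess n ?t\<bar> < e n"
        using elim by simp
      ultimately show ?case
        using n unfolding dist_real_def by linarith
    qed
  qed
  moreover have "(\<lambda>x\<in>topspace X. G m (trace_upto U m x)) \<in> trace_functions X U" for m
    using q unfolding trace_functions_def by (fastforce simp: G_def guess_def)
  ultimately show "\<exists>s::nat \<Rightarrow> _. (\<forall>n. s n \<in> trace_functions X U) \<and>
      (\<forall>x\<in>topspace X. (\<lambda>n. s n x) \<longlonglongrightarrow> f x)"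
    by (intro exI[of _ "\<lambda>m. \<lambda>x\<in>topspace X. G m (trace_upto U m x)"]) simp
qed

lemma O_property_imp_sequentially_separable:
  assumes "O_property X"
  shows "sequentially_separable (baire_function_space X)"
proof -
  have "\<exists>U. sequentially_dense_in (baire_function_space X) (trace_functions X U)"
    by (rule O_property_countable_base[OF assms])
      (rule exI, rule trace_functions_sequentially_dense)
  then show ?thesis
    unfolding sequentially_separable_def using countable_trace_functions by auto
qed

section \<open>From covers to functions\<close>

text \<open>Repetitions do no harm: a set that occurs infinitely often in a sequence with the
  \<open>\<gamma>\<close>-property contains every point, so a sequence of proper subsets has an infinite range.\<close>

lemma baire_GammaI:
  assumes "\<And>i::nat. U i \<in> baire_sets X" and "\<And>i. U i \<noteq> topspace X"
    and cofin: "\<And>x. x \<in> topspace X \<Longrightarrow> \<forall>\<^sub>F i in sequentially. x \<in> U i"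
  shows "range U \<in> baire_Gamma X"
proof -
  have fin: "finite {i. x \<notin> U i}" if "x \<in> topspace X" for x
    using cofin[OF that] by (simp add: sequentially_imp_eventually_within eventually_sequentially
      not_le finite_nat_set_iff_bounded) (metis not_le)
  have sub: "U i \<subseteq> topspace X" for i
    using assms(1) by (rule baire_sets_subset)
  have "infinite (range U)"
  proof
    assume "finite (range U)"
    then obtain i where i: "infinite {j. U j = U i}"
      using pigeonhole_infinite[of UNIV U] by auto
    obtain x where x: "x \<in> topspace X" "x \<notin> U i"
      using assms(2) sub by blast
    then have "{j. U j = U i} \<subseteq> {j. x \<notin> U j}" by auto
    with fin[OF x(1)] i show False
      using finite_subset by blast
  qed
  moreover have "finite {V \<in> range U. x \<notin> V}" if "x \<in> topspace X" for x
  proof (rule finite_subset)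
    show "{V \<in> range U. x \<notin> V} \<subseteq> U ` {i. x \<notin> U i}" by auto
  qed (use fin[OF that] in simp)
  moreover have "\<Union>(range U) = topspace X"
  proof
    show "topspace X \<subseteq> \<Union>(range U)"
    proof
      fix x assume "x \<in> topspace X"
      from cofin[OF this] obtain i where "x \<in> U i"
        by (auto simp: eventually_sequentially)
      then show "x \<in> \<Union>(range U)" by blast
    qed
  qed (use sub in blast)
  moreover have "topspace X \<notin> range U"
    using assms(2) by (metis rangeE)
  ultimately show ?thesis
    using assms(1) sub by (simp add: baire_Gamma_def gamma_cover_def image_subset_iff)
qed

text \<open>The selection principle for covers, freed of its nontriviality conditions: for sequences of
  Baire sets instead of covers. If the whole space occurs among the sets, choosing it is already
  enough.\<close>

lemma indexed_selection:
  assumes S1: "S_one (baire_Gamma X) (baire_Omega X)"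
    and U: "\<And>n i. U n i \<in> baire_sets X"
    and cofin: "\<And>n x. x \<in> topspace X \<Longrightarrow> \<forall>\<^sub>F i in sequentially. x \<in> U n i"
  shows "\<exists>h::nat \<Rightarrow> nat. \<forall>K. finite K \<and> K \<subseteq> topspace X \<longrightarrow> (\<exists>n. K \<subseteq> U n (h n))"
proof (cases "\<exists>n i. U n i = topspace X")
  case True
  then obtain n i where "U n i = topspace X" by blast
  then show ?thesis
    by (intro exI[of _ "\<lambda>_. i"]) auto
next
  case False
  then have "range (U n) \<in> baire_Gamma X" for n
    using U cofin by (intro baire_GammaI) auto
  then have "\<forall>n. range (U n) \<in> baire_Gamma X" ..
  with S1 have "\<exists>b. (\<forall>n. b n \<in> range (U n)) \<and> range b \<in> baire_Omega X"
    unfolding S_one_def by simp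
  then obtain b where b: "\<forall>n. b n \<in> range (U n)" "range b \<in> baire_Omega X"
    by blast
  then have "\<forall>n. \<exists>i. b n = U n i" by blast
  then obtain h where h: "\<And>n. b n = U n (h n)" by metis
  have "\<exists>n. K \<subseteq> U n (h n)" if "finite K" "K \<subseteq> topspace X" for K
  proof -
    have "\<exists>V\<in>range b. K \<subseteq> V"
      using b(2) that by (simp add: baire_Omega_def omega_cover_def)
    then show ?thesis by (auto simp: h)
  qed
  then show ?thesis by blast
qed

text \<open>Each finite set is to be served at arbitrarily late stages, so that the errors
  \<open>inverse (Suc n)\<close> get small. To this end the stages are split into infinitely many infinite
  sequences by the pairing function, and the selection is made separately along each: the
  sequence with number \<open>N\<close> consists of stages \<open>\<ge> N\<close>.\<close>

lemma select_close_to_targets: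
  fixes a :: "nat \<Rightarrow> nat \<Rightarrow> 'a \<Rightarrow> real"
  assumes S1: "S_one (baire_Gamma X) (baire_Omega X)"
    and a: "\<And>n i. a n i \<in> baire_functions X" and f: "\<And>n. f n \<in> baire_functions X"
    and lim: "\<And>n x. x \<in> topspace X \<Longrightarrow> (\<lambda>i. a n i x) \<longlonglongrightarrow> f n x"
  shows "\<exists>h. \<forall>K N. finite K \<and> K \<subseteq> topspace X \<longrightarrow>
    (\<exists>n\<ge>N. \<forall>x\<in>K. \<bar>a n (h n) x - f n x\<bar> < inverse (Suc n))"
proof -
  define U where "U n i = {x \<in> topspace X. \<bar>a n i x - f n x\<bar> < inverse (Suc n)}" for n i
  have U: "U n i \<in> baire_sets X" for n i
  proof -
    have [measurable]: "a n i \<in> borel_measurable (baire_algebra X)"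
        "f n \<in> borel_measurable (baire_algebra X)"
      using a f by (auto intro: baire_function_measurable)
    have "{x \<in> space (baire_algebra X). \<bar>a n i x - f n x\<bar> < inverse (Suc n)}
        \<in> sets (baire_algebra X)"
      by measurable
    then show ?thesis by (simp add: U_def)
  qed
  have cofin: "\<forall>\<^sub>F i in sequentially. x \<in> U n i" if x: "x \<in> topspace X" for n x
  proof -
    have "\<forall>\<^sub>F i in sequentially. dist (a n i x) (f n x) < inverse (Suc n)"
      by (rule tendstoD[OF lim[OF x]]) simp
    then show ?thesis
      using x by (simp add: U_def dist_real_def)
  qed
  have "\<forall>p. \<exists>h::nat \<Rightarrow> nat. \<forall>K. finite K \<and> K \<subseteq> topspace X \<longrightarrow>
      (\<exists>q. K \<subseteq> U (prod_encode (p, q)) (h q))"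
    by (intro allI indexed_selection[OF S1] U cofin)
  from choice[OF this] obtain h where h: "\<forall>p K. finite K \<and> K \<subseteq> topspace X \<longrightarrow>
      (\<exists>q. K \<subseteq> U (prod_encode (p, q)) (h p q))" ..
  define h' where "h' n = h (fst (prod_decode n)) (snd (prod_decode n))" for n
  have "\<exists>n\<ge>N. \<forall>x\<in>K. \<bar>a n (h' n) x - f n x\<bar> < inverse (Suc n)"
    if K: "finite K" "K \<subseteq> topspace X" for K N
  proof -
    obtain q where q: "K \<subseteq> U (prod_encode (N, q)) (h N q)"
      using h K by blast
    then have "K \<subseteq> U (prod_encode (N, q)) (h' (prod_encode (N, q)))"
      by (simp add: h'_def)
    then show ?thesis
      using le_prod_encode_1[of N q] unfolding U_def by blast
  qed
  then show ?thesis by blast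
qed

lemma select_close_to_limit:
  fixes a :: "nat \<Rightarrow> nat \<Rightarrow> 'a \<Rightarrow> real"
  assumes "S_one (baire_Gamma X) (baire_Omega X)"
    and "\<And>n i. a n i \<in> baire_functions X" "\<And>n. f n \<in> baire_functions X"
    and "\<And>n x. x \<in> topspace X \<Longrightarrow> (\<lambda>i. a n i x) \<longlonglongrightarrow> f n x"
    and f_lim: "\<And>x. x \<in> topspace X \<Longrightarrow> (\<lambda>n. f n x) \<longlonglongrightarrow> g x"
  shows "\<exists>h. \<forall>K \<epsilon>. finite K \<and> K \<subseteq> topspace X \<and> \<epsilon> > 0 \<longrightarrow>
    (\<exists>n. \<forall>x\<in>K. \<bar>a n (h n) x - g x\<bar> < \<epsilon>)"
proof -
  obtain h where h: "\<forall>K N. finite K \<and> K \<subseteq> topspace X \<longrightarrow>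
      (\<exists>n\<ge>N. \<forall>x\<in>K. \<bar>a n (h n) x - f n x\<bar> < inverse (Suc n))"
    using select_close_to_targets[OF assms(1-4)] ..
  have "\<exists>n. \<forall>x\<in>K. \<bar>a n (h n) x - g x\<bar> < \<epsilon>"
    if K: "finite K" "K \<subseteq> topspace X" and \<epsilon>: "\<epsilon> > 0" for K \<epsilon>
  proof -
    have "\<forall>\<^sub>F n in sequentially. \<bar>f n x - g x\<bar> < \<epsilon> / 2" if "x \<in> K" for x
      using tendstoD[OF f_lim, of x "\<epsilon> / 2"] that K(2) \<epsilon> by (auto simp: dist_real_def)
    then have "\<forall>\<^sub>F n in sequentially. \<forall>x\<in>K. \<bar>f n x - g x\<bar> < \<epsilon> / 2"
      using K(1) by (intro eventually_ball_finite) auto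
    moreover have "\<forall>\<^sub>F n in sequentially. inverse (real (Suc n)) < \<epsilon> / 2"
      using \<epsilon> by (intro order_tendstoD(2)[OF LIMSEQ_inverse_real_of_nat]) auto
    ultimately have "\<forall>\<^sub>F n in sequentially. inverse (real (Suc n)) < \<epsilon> / 2 \<and>
        (\<forall>x\<in>K. \<bar>f n x - g x\<bar> < \<epsilon> / 2)"
      by eventually_elim blast
    then obtain N where N: "\<And>n. n \<ge> N \<Longrightarrow> inverse (real (Suc n)) < \<epsilon> / 2 \<and>
        (\<forall>x\<in>K. \<bar>f n x - g x\<bar> < \<epsilon> / 2)"
      unfolding eventually_sequentially by blast
    obtain n where n: "n \<ge> N" "\<forall>x\<in>K. \<bar>a n (h n) x - f n x\<bar> < inverse (Suc n)"
      using h K by blast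
    have "\<bar>a n (h n) x - g x\<bar> < \<epsilon>" if "x \<in> K" for x
    proof -
      have "\<bar>a n (h n) x - f n x\<bar> < inverse (Suc n)" "inverse (real (Suc n)) < \<epsilon> / 2"
          "\<bar>f n x - g x\<bar> < \<epsilon> / 2"
        using n N[OF n(1)] that by blast+
      then show ?thesis by linarith
    qed
    then show ?thesis by blast
  qed
  then show ?thesis by blast
qed

lemma Omega_at_baire_function_space:
  "A \<in> Omega_at (baire_function_space X) f \<longleftrightarrow> A \<subseteq> baire_functions X \<and> f \<in> baire_functions X \<and>
    f \<notin> A \<and> (\<forall>K \<epsilon>. finite K \<and> K \<subseteq> topspace X \<and> \<epsilon> > 0 \<longrightarrow> (\<exists>g\<in>A. \<forall>x\<in>K. \<bar>g x - f x\<bar> < \<epsilon>))"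
proof (cases "A \<subseteq> baire_functions X")
  case True
  then show ?thesis
    unfolding Omega_at_def mem_Collect_eq topspace_baire_function_space Diff_iff
      in_closure_baire_function_space[OF True]
    by (simp only: conj_ac)
qed (simp add: Omega_at_def)

lemma countable_dense_baire_function_space:
  "A \<in> countable_dense_sets (baire_function_space X) \<longleftrightarrow> countable A \<and> A \<subseteq> baire_functions X \<and>
    (\<forall>f K \<epsilon>. f \<in> baire_functions X \<and> finite K \<and> K \<subseteq> topspace X \<and> \<epsilon> > 0 \<longrightarrow>
      (\<exists>g\<in>A. \<forall>x\<in>K. \<bar>g x - f x\<bar> < \<epsilon>))" 
proof (cases "A \<subseteq> baire_functions X")
  case True
  have "baire_function_space X closure_of A = baire_functions X \<longleftrightarrow>
      (\<forall>f\<in>baire_functions X. f \<in> baire_function_space X closure_of A)"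
    using closure_of_subset_topspace[of "baire_function_space X" A] by auto
  also have "\<dots> \<longleftrightarrow> (\<forall>f K \<epsilon>. f \<in> baire_functions X \<and> finite K \<and> K \<subseteq> topspace X \<and> \<epsilon> > 0 \<longrightarrow>
      (\<exists>g\<in>A. \<forall>x\<in>K. \<bar>g x - f x\<bar> < \<epsilon>))"
    unfolding in_closure_baire_function_space[OF True] Ball_def by (simp add: imp_conjL)
  finally show ?thesis
    by (simp add: countable_dense_sets_def)
qed (simp add: countable_dense_sets_def)

lemma seq_dense_approx:
  assumes D: "sequentially_dense_in (baire_function_space X) D" and f: "f \<in> baire_functions X"
    and K: "finite K" "K \<subseteq> topspace X" "\<epsilon> > 0"
  shows "\<exists>g\<in>D. \<forall>x\<in>K. \<bar>g x - f x\<bar> < \<epsilon>"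
proof -
  obtain s :: "nat \<Rightarrow> _" where s: "(\<forall>n. s n \<in> D) \<and> (\<forall>x\<in>topspace X. (\<lambda>n. s n x) \<longlonglongrightarrow> f x)"
    using pointwise_sequence_in_seq_dense[OF D f] ..
  have "\<forall>\<^sub>F n in sequentially. \<bar>s n x - f x\<bar> < \<epsilon>" if "x \<in> K" for x
    using tendstoD[of "\<lambda>n. s n x" "f x" _ \<epsilon>] s that K(2,3) by (auto simp: dist_real_def)
  then have "\<forall>\<^sub>F n in sequentially. \<forall>x\<in>K. \<bar>s n x - f x\<bar> < \<epsilon>"
    using K(1) by (intro eventually_ball_finite) auto
  then obtain n where "\<forall>x\<in>K. \<bar>s n x - f x\<bar> < \<epsilon>"
    unfolding eventually_sequentially by blast
  with s show ?thesis by blast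
qed

lemma countable_seq_dense_sets_iff:
  "S \<in> countable_seq_dense_sets (baire_function_space X) \<longleftrightarrow>
    countable S \<and> sequentially_dense_in (baire_function_space X) S"
  by (simp add: countable_seq_dense_sets_def)

lemma seq_dense_subset:
  "sequentially_dense_in (baire_function_space X) S \<Longrightarrow> S \<subseteq> baire_functions X"
  by (simp add: sequentially_dense_in_def)

text \<open>Splitting the stages by the pairing function, the stages \<open>(p, q)\<close> with fixed \<open>p\<close> are devoted to
  the approximation of the \<open>p\<close>-th member of a countable dense set.\<close>

lemma S_one_covers_imp_S_one_seq_dense_dense:
  assumes S1: "S_one (baire_Gamma X) (baire_Omega X)"
    and sep: "sequentially_separable (baire_function_space X)"
  shows "S_one (countable_seq_dense_sets (baire_function_space X))
    (countable_dense_sets (baire_function_space X))"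
  unfolding S_one_def
proof (intro allI impI)
  fix S :: "nat \<Rightarrow> ('a \<Rightarrow> real) set"
  assume S: "\<forall>n. S n \<in> countable_seq_dense_sets (baire_function_space X)"
  then have dense: "sequentially_dense_in (baire_function_space X) (S n)" for n
    by (simp add: countable_seq_dense_sets_iff)
  obtain D where D: "countable D" "sequentially_dense_in (baire_function_space X) D"
    using sep by (auto simp: sequentially_separable_def)
  define d where "d = from_nat_into D"
  have d: "range d = D"
    using D(1) seq_dense_nonempty[OF D(2)] by (simp add: d_def range_from_nat_into)
  then have d_baire: "d p \<in> baire_functions X" for p
    using seq_dense_subset[OF D(2)] by blast
  have "\<forall>p. \<exists>b. (\<forall>q. b q \<in> S (prod_encode (p, q))) \<and>
      (\<forall>K \<epsilon>. finite K \<and> K \<subseteq> topspace X \<and> \<epsilon> > 0 \<longrightarrow> (\<exists>q. \<forall>x\<in>K. \<bar>b q x - d p x\<bar> < \<epsilon>))"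
  proof
    fix p
    have "\<forall>q. \<exists>s::nat \<Rightarrow> _. (\<forall>i. s i \<in> S (prod_encode (p, q))) \<and>
        (\<forall>x\<in>topspace X. (\<lambda>i. s i x) \<longlonglongrightarrow> d p x)"
      by (intro allI pointwise_sequence_in_seq_dense[OF dense d_baire])
    from choice[OF this] obtain a :: "nat \<Rightarrow> nat \<Rightarrow> _" where
      a: "\<forall>q. (\<forall>i. a q i \<in> S (prod_encode (p, q))) \<and>
        (\<forall>x\<in>topspace X. (\<lambda>i. a q i x) \<longlonglongrightarrow> d p x)" ..
    have a_baire: "a q i \<in> baire_functions X" for q i
      using a seq_dense_subset[OF dense] by blast
    have a_lim: "(\<lambda>i. a q i x) \<longlonglongrightarrow> d p x" if "x \<in> topspace X" for q x
      using a that by simp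
    obtain h where "\<forall>K \<epsilon>. finite K \<and> K \<subseteq> topspace X \<and> \<epsilon> > 0 \<longrightarrow>
        (\<exists>q. \<forall>x\<in>K. \<bar>a q (h q) x - d p x\<bar> < \<epsilon>)"
      using select_close_to_limit[OF S1 a_baire d_baire a_lim tendsto_const] ..
    with a show "\<exists>b. (\<forall>q. b q \<in> S (prod_encode (p, q))) \<and>
        (\<forall>K \<epsilon>. finite K \<and> K \<subseteq> topspace X \<and> \<epsilon> > 0 \<longrightarrow> (\<exists>q. \<forall>x\<in>K. \<bar>b q x - d p x\<bar> < \<epsilon>))"
      by (intro exI[of _ "\<lambda>q. a q (h q)"]) simp
  qed
  from choice[OF this] obtain b where b: "\<forall>p. (\<forall>q. b p q \<in> S (prod_encode (p, q))) \<and>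
      (\<forall>K \<epsilon>. finite K \<and> K \<subseteq> topspace X \<and> \<epsilon> > 0 \<longrightarrow> (\<exists>q. \<forall>x\<in>K. \<bar>b p q x - d p x\<bar> < \<epsilon>))" ..
  define c where "c n = b (fst (prod_decode n)) (snd (prod_decode n))" for n
  have c: "c n \<in> S n" for n
  proof -
    have "b (fst (prod_decode n)) (snd (prod_decode n))
        \<in> S (prod_encode (fst (prod_decode n), snd (prod_decode n)))"
      using b by blast
    then show ?thesis by (simp add: c_def)
  qed
  have "\<exists>g\<in>range c. \<forall>x\<in>K. \<bar>g x - f x\<bar> < \<epsilon>"
    if f: "f \<in> baire_functions X" and K: "finite K" "K \<subseteq> topspace X" "\<epsilon> > 0" for f K \<epsilon>
  proof -
    have "\<exists>g\<in>D. \<forall>x\<in>K. \<bar>g x - f x\<bar> < \<epsilon> / 2"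
      using seq_dense_approx[OF D(2) f K(1,2) half_gt_zero[OF K(3)]] .
    then obtain p where p: "\<forall>x\<in>K. \<bar>d p x - f x\<bar> < \<epsilon> / 2"
      using d by blast
    have "\<epsilon> / 2 > 0" using K(3) by simp
    then obtain q where q: "\<forall>x\<in>K. \<bar>b p q x - d p x\<bar> < \<epsilon> / 2"
      using b K(1,2) by blast
    have "\<bar>c (prod_encode (p, q)) x - f x\<bar> < \<epsilon>" if "x \<in> K" for x
    proof -
      have "c (prod_encode (p, q)) x = b p q x" by (simp add: c_def)
      moreover have "\<bar>d p x - f x\<bar> < \<epsilon> / 2" "\<bar>b p q x - d p x\<bar> < \<epsilon> / 2"
        using p q that by simp_all
      ultimately show ?thesis by linarith
    qed
    then show ?thesis by blast
  qed
  moreover have "range c \<subseteq> baire_functions X"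
    using c seq_dense_subset[OF dense] by blast
  ultimately have "range c \<in> countable_dense_sets (baire_function_space X)"
    by (simp add: countable_dense_baire_function_space)
  with c show "\<exists>b. (\<forall>n. b n \<in> S n) \<and> range b \<in> countable_dense_sets (baire_function_space X)"
    by blast
qed

lemma Gamma_at_sequence:
  assumes A: "A \<in> Gamma_at (baire_function_space X) f" and f: "f \<in> baire_functions X"
  shows "\<exists>s::nat \<Rightarrow> _. (\<forall>i. s i \<in> A) \<and> (\<forall>x\<in>topspace X. (\<lambda>i. s i x) \<longlonglongrightarrow> f x)"
proof -
  have cA: "countable A" "infinite A" and
    fin: "\<And>U. openin (baire_function_space X) U \<Longrightarrow> f \<in> U \<Longrightarrow> finite (A - U)"
    and sub: "A \<subseteq> baire_functions X"
    using A by (auto simp: Gamma_at_def)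
  define s where "s = from_nat_into A"
  have s: "s i \<in> A" for i
    using cA unfolding s_def by (intro from_nat_into) auto
  have inj: "inj s"
    using bij_betw_from_nat_into[OF cA] by (simp add: s_def bij_betw_def)
  have "(\<lambda>i. s i x) \<longlonglongrightarrow> f x" if x: "x \<in> topspace X" for x
  proof (rule tendstoI)
    fix \<epsilon> :: real assume "\<epsilon> > 0"
    then have "finite (A - pointwise_nbhd X f {x} \<epsilon>)"
      using x f by (intro fin openin_pointwise_nbhd) (auto simp: pointwise_nbhd_def)
    then have "finite (s -` (A - pointwise_nbhd X f {x} \<epsilon>))"
      using inj by (intro finite_vimageI)
    then have "finite {i. \<not> dist (s i x) (f x) < \<epsilon>}"
      by (rule finite_subset[rotated]) (use s in \<open>auto simp: pointwise_nbhd_def dist_real_def\<close>)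
    then show "\<forall>\<^sub>F i in sequentially. dist (s i x) (f x) < \<epsilon>"
      by (simp add: cofinite_eq_sequentially[symmetric] eventually_cofinite)
  qed
  with s show ?thesis by blast
qed

lemma S_one_covers_imp_S_one_Gamma_at_Omega_at:
  assumes S1: "S_one (baire_Gamma X) (baire_Omega X)"
    and f: "f \<in> baire_functions X"
  shows "S_one (Gamma_at (baire_function_space X) f) (Omega_at (baire_function_space X) f)"
  unfolding S_one_def
proof (intro allI impI)
  fix A :: "nat \<Rightarrow> ('a \<Rightarrow> real) set"
  assume A: "\<forall>n. A n \<in> Gamma_at (baire_function_space X) f"
  have "\<forall>n. \<exists>s::nat \<Rightarrow> _. (\<forall>i. s i \<in> A n) \<and> (\<forall>x\<in>topspace X. (\<lambda>i. s i x) \<longlonglongrightarrow> f x)"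
    using A by (intro allI Gamma_at_sequence[OF _ f]) simp
  from choice[OF this] obtain a :: "nat \<Rightarrow> nat \<Rightarrow> _" where
    a: "\<forall>n. (\<forall>i. a n i \<in> A n) \<and> (\<forall>x\<in>topspace X. (\<lambda>i. a n i x) \<longlonglongrightarrow> f x)" ..
  have sub: "A n \<subseteq> baire_functions X" "f \<notin> A n" for n
    using A by (auto simp: Gamma_at_def)
  have a_baire: "a n i \<in> baire_functions X" for n i
    using a sub by blast
  have a_lim: "(\<lambda>i. a n i x) \<longlonglongrightarrow> f x" if "x \<in> topspace X" for n x
    using a that by simp
  obtain h where h: "\<forall>K \<epsilon>. finite K \<and> K \<subseteq> topspace X \<and> \<epsilon> > 0 \<longrightarrow>
      (\<exists>n. \<forall>x\<in>K. \<bar>a n (h n) x - f x\<bar> < \<epsilon>)"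
    using select_close_to_limit[OF S1 a_baire f a_lim tendsto_const] ..
  have "range (\<lambda>n. a n (h n)) \<in> Omega_at (baire_function_space X) f"
    unfolding Omega_at_baire_function_space
  proof (intro conjI)
    show "f \<notin> range (\<lambda>n. a n (h n))"
      using a sub(2) by blast
  qed (use h a_baire f in auto)
  with a show "\<exists>b. (\<forall>n. b n \<in> A n) \<and> range b \<in> Omega_at (baire_function_space X) f"
    by (intro exI[of _ "\<lambda>n. a n (h n)"]) simp
qed

text \<open>Prescribing a forbidden value \<open>c\<close> at one point is how a selection is kept away from a
  given function.\<close>

lemma seq_dense_sequence_avoiding:
  assumes S: "sequentially_dense_in (baire_function_space X) S"
    and f: "f \<in> baire_functions X" and x0: "x0 \<in> topspace X" and "f x0 \<noteq> c"
  shows "\<exists>s::nat \<Rightarrow> _. (\<forall>i. s i \<in> S \<and> s i x0 \<noteq> c) \<and> (\<forall>x\<in>topspace X. (\<lambda>i. s i x) \<longlonglongrightarrow> f x)"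
proof -
  obtain s :: "nat \<Rightarrow> _" where s: "(\<forall>n. s n \<in> S) \<and> (\<forall>x\<in>topspace X. (\<lambda>n. s n x) \<longlonglongrightarrow> f x)"
    using pointwise_sequence_in_seq_dense[OF S f] ..
  then have "\<forall>\<^sub>F n in sequentially. s n x0 \<noteq> c"
    using x0 \<open>f x0 \<noteq> c\<close> by (intro tendsto_imp_eventually_ne[where F = sequentially]) auto
  then obtain N where N: "\<And>n. n \<ge> N \<Longrightarrow> s n x0 \<noteq> c"
    by (auto simp: eventually_sequentially)
  show ?thesis
  proof (intro exI[of _ "\<lambda>n. s (n + N)"] conjI allI ballI)
    fix x assume "x \<in> topspace X"
    then show "(\<lambda>n. s (n + N) x) \<longlonglongrightarrow> f x"
      using s LIMSEQ_ignore_initial_segment[of "\<lambda>n. s n x"] by blast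
  qed (use s N in auto)
qed

text \<open>The set selected must not contain \<open>f\<close>, although the given sets may. So the \<open>n\<close>-th selection
  aims at \<open>f + inverse (Suc n)\<close>, among functions that differ from \<open>f\<close> at a fixed point.\<close>

lemma S_one_covers_imp_S_one_seq_dense_Omega_at:
  assumes S1: "S_one (baire_Gamma X) (baire_Omega X)" and ne: "topspace X \<noteq> {}"
    and f: "f \<in> baire_functions X"
  shows "S_one (countable_seq_dense_sets (baire_function_space X))
    (Omega_at (baire_function_space X) f)"
  unfolding S_one_def
proof (intro allI impI)
  fix S :: "nat \<Rightarrow> ('a \<Rightarrow> real) set"
  assume "\<forall>n. S n \<in> countable_seq_dense_sets (baire_function_space X)"
  then have dense: "sequentially_dense_in (baire_function_space X) (S n)" for n
    by (simp add: countable_seq_dense_sets_iff)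
  obtain x0 where x0: "x0 \<in> topspace X" using ne by blast
  define g where "g n = (\<lambda>x\<in>topspace X. f x + inverse (real (Suc n)))" for n
  have g: "g n \<in> baire_functions X" for n
  proof -
    have "(\<lambda>x. f x + inverse (real (Suc n))) \<in> borel_measurable (baire_algebra X)"
      using baire_function_measurable[OF f] by measurable
    then have "g n \<in> borel_measurable (baire_algebra X)"
      by (rule measurable_cong[THEN iffD1, rotated]) (simp add: g_def)
    moreover have "g n \<in> extensional (topspace X)"
      unfolding g_def by (rule restrict_extensional)
    ultimately show ?thesis by (simp add: baire_functions_eq)
  qed
  have g_lim: "(\<lambda>n. g n x) \<longlonglongrightarrow> f x" if "x \<in> topspace X" for x
  proof -
    have "(\<lambda>n. f x + inverse (real (Suc n))) \<longlonglongrightarrow> f x + 0"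
      by (intro tendsto_add tendsto_const LIMSEQ_inverse_real_of_nat)
    with that show ?thesis by (simp add: g_def)
  qed
  have "\<forall>n. \<exists>s::nat \<Rightarrow> _. (\<forall>i. s i \<in> S n \<and> s i x0 \<noteq> f x0) \<and>
      (\<forall>x\<in>topspace X. (\<lambda>i. s i x) \<longlonglongrightarrow> g n x)"
  proof
    fix n
    have "g n x0 \<noteq> f x0" using x0 by (simp add: g_def)
    then show "\<exists>s::nat \<Rightarrow> _. (\<forall>i. s i \<in> S n \<and> s i x0 \<noteq> f x0) \<and>
      (\<forall>x\<in>topspace X. (\<lambda>i. s i x) \<longlonglongrightarrow> g n x)"
      by (rule seq_dense_sequence_avoiding[OF dense g x0])
  qed
  from choice[OF this] obtain a :: "nat \<Rightarrow> nat \<Rightarrow> _" where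
    a: "\<forall>n. (\<forall>i. a n i \<in> S n \<and> a n i x0 \<noteq> f x0) \<and>
      (\<forall>x\<in>topspace X. (\<lambda>i. a n i x) \<longlonglongrightarrow> g n x)" ..
  have a_baire: "a n i \<in> baire_functions X" for n i
    using a seq_dense_subset[OF dense] by blast
  have a_lim: "(\<lambda>i. a n i x) \<longlonglongrightarrow> g n x" if "x \<in> topspace X" for n x
    using a that by simp
  obtain h where h: "\<forall>K \<epsilon>. finite K \<and> K \<subseteq> topspace X \<and> \<epsilon> > 0 \<longrightarrow>
      (\<exists>n. \<forall>x\<in>K. \<bar>a n (h n) x - f x\<bar> < \<epsilon>)"
    using select_close_to_limit[OF S1 a_baire g a_lim g_lim] ..
  have "range (\<lambda>n. a n (h n)) \<in> Omega_at (baire_function_space X) f"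
    unfolding Omega_at_baire_function_space
  proof (intro conjI)
    show "f \<notin> range (\<lambda>n. a n (h n))"
      using a by (metis rangeE)
  qed (use h a_baire f in auto)
  with a show "\<exists>b. (\<forall>n. b n \<in> S n) \<and> range b \<in> Omega_at (baire_function_space X) f"
    by (intro exI[of _ "\<lambda>n. a n (h n)"]) simp
qed

section \<open>From functions to covers\<close>

text \<open>A sequence that converges to a function not among its members has infinitely many different
  members.\<close>

lemma Gamma_at_subset_of_seq_dense:
  assumes S: "sequentially_dense_in (baire_function_space X) S"
    and f: "f \<in> baire_functions X" "f \<notin> S"
  shows "\<exists>A\<subseteq>S. A \<in> Gamma_at (baire_function_space X) f"
proof -
  obtain s :: "nat \<Rightarrow> _" where s: "(\<forall>n. s n \<in> S) \<and> (\<forall>x\<in>topspace X. (\<lambda>n. s n x) \<longlonglongrightarrow> f x)"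
    using pointwise_sequence_in_seq_dense[OF S f(1)] ..
  then have s_baire: "s n \<in> baire_functions X" for n
    using seq_dense_subset[OF S] by blast
  have "infinite (range s)"
  proof
    assume fin: "finite (range s)"
    have "\<forall>\<^sub>F i in sequentially. s i \<noteq> g" if "g \<in> range s" for g
    proof -
      have g: "g \<in> extensional (topspace X)" "g \<noteq> f"
        using that s f(2) baire_function_extensional[OF s_baire] by auto
      then obtain x where x: "x \<in> topspace X" "f x \<noteq> g x"
        using extensionalityI[OF g(1) baire_function_extensional[OF f(1)]] by metis
      then have "\<forall>\<^sub>F i in sequentially. s i x \<noteq> g x"
        using s by (intro tendsto_imp_eventually_ne[where F = sequentially]) auto
      then show ?thesis
        by (rule eventually_mono) auto
    qed
    then have "\<forall>\<^sub>F i in sequentially. \<forall>g\<in>range s. s i \<noteq> g"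
      using fin by (intro eventually_ball_finite) auto
    then show False
      by (auto simp: eventually_sequentially)
  qed
  moreover have "finite (range s - U)" if U: "openin (baire_function_space X) U \<and> f \<in> U" for U
  proof -
    have "limitin (baire_function_space X) s f sequentially"
      using s s_baire f(1) by (simp add: limitin_baire_function_space)
    then have "\<forall>\<^sub>F i in sequentially. s i \<in> U"
      using U by (simp add: limitin_def)
    then obtain N where N: "\<And>i. i \<ge> N \<Longrightarrow> s i \<in> U"
      by (auto simp: eventually_sequentially)
    have "range s - U \<subseteq> s ` {..<N}"
    proof
      fix g assume "g \<in> range s - U"
      then obtain i where i: "g = s i" "s i \<notin> U" by auto
      then have "i < N" using N not_le by blast
      with i show "g \<in> s ` {..<N}" by blast
    qed
    then show ?thesis
      by (rule finite_subset) simp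
  qed
  moreover have "f \<notin> range s" using s f(2) by auto
  moreover have "range s \<subseteq> baire_functions X" using s_baire by blast
  ultimately have "range s \<in> Gamma_at (baire_function_space X) f"
    by (simp add: Gamma_at_def)
  moreover have "range s \<subseteq> S" using s by blast
  ultimately show ?thesis by blast
qed

text \<open>If \<open>f\<close> itself belongs to one of the given sets, it may be selected there; otherwise each of
  them contains a sequence that converges to \<open>f\<close> without containing it.\<close>

lemma S_one_Gamma_at_imp_U_fin_seq_dense:
  assumes S1: "S_one (Gamma_at (baire_function_space X) f) (Omega_at (baire_function_space X) f)"
    and f: "f \<in> baire_functions X"
  shows "U_fin_seq_dense_Omega_at X f"
  unfolding U_fin_seq_dense_Omega_at_def
proof (intro allI impI)
  fix S :: "nat \<Rightarrow> ('a \<Rightarrow> real) set"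
  assume "\<forall>n. S n \<in> countable_seq_dense_sets (baire_function_space X)"
  then have dense: "sequentially_dense_in (baire_function_space X) (S n)" for n
    by (simp add: countable_seq_dense_sets_iff)
  show "\<exists>F. (\<forall>n. finite (F n) \<and> F n \<subseteq> S n) \<and> (\<forall>K \<epsilon>. finite K \<and> K \<subseteq> topspace X \<and> 0 < \<epsilon> \<longrightarrow>
      (\<exists>n. \<forall>x\<in>K. \<exists>g\<in>F n. \<bar>g x - f x\<bar> < \<epsilon>))"
  proof (cases "\<exists>n. f \<in> S n")
    case True
    then obtain m where "f \<in> S m" ..
    then show ?thesis
      by (intro exI[of _ "\<lambda>n. if n = m then {f} else {}"]) auto
  next
    case False
    then have "\<forall>n. \<exists>A\<subseteq>S n. A \<in> Gamma_at (baire_function_space X) f"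
      by (intro allI Gamma_at_subset_of_seq_dense[OF dense f]) simp
    then obtain A where A: "\<forall>n. A n \<subseteq> S n \<and> A n \<in> Gamma_at (baire_function_space X) f"
      by metis
    then obtain b where b: "\<forall>n. b n \<in> A n" "range b \<in> Omega_at (baire_function_space X) f"
      using S1 unfolding S_one_def by blast
    have "\<exists>n. \<forall>x\<in>K. \<exists>g\<in>{b n}. \<bar>g x - f x\<bar> < \<epsilon>"
      if K: "finite K \<and> K \<subseteq> topspace X \<and> 0 < \<epsilon>" for K \<epsilon>
    proof -
      have "\<exists>g\<in>range b. \<forall>x\<in>K. \<bar>g x - f x\<bar> < \<epsilon>"
        using b(2) K unfolding Omega_at_baire_function_space by simp
      then show ?thesis by simp
    qed
    moreover have "b n \<in> S n" for n
      using A b(1) by blast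
    ultimately show ?thesis
      by (intro exI[of _ "\<lambda>n. {b n}"]) simp
  qed
qed

text \<open>Replacing functions by a constant off \<open>V i\<close> does not spoil sequential density, since each point
  is affected by finitely many \<open>i\<close> only. This encodes the cover into a sequentially dense set:
  where a truncated function differs from \<open>c\<close>, the point lies in \<open>V i\<close>.\<close>

lemma truncations_seq_dense:
  assumes V: "\<And>i::nat. V i \<in> baire_sets X"
    and cofin: "\<And>x. x \<in> topspace X \<Longrightarrow> \<forall>\<^sub>F i in sequentially. x \<in> V i"
    and D: "countable D" "sequentially_dense_in (baire_function_space X) D"
  shows "(\<lambda>(i, d). \<lambda>x\<in>topspace X. if x \<in> V i then d x else c) ` (UNIV \<times> D)
    \<in> countable_seq_dense_sets (baire_function_space X)"
    (is "?S \<in> _")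
proof -
  have "sequentially_dense_in (baire_function_space X) ?S"
  proof (rule sequentially_dense_inI)
    have "(\<lambda>x\<in>topspace X. if x \<in> V i then d x else c) \<in> baire_functions X" if "d \<in> D" for i d
    proof -
      have d: "d \<in> borel_measurable (baire_algebra X)"
        using seq_dense_subset[OF D(2)] that baire_function_measurable by blast
      have "{x \<in> space (baire_algebra X). x \<in> V i} \<in> sets (baire_algebra X)"
        using V[of i] baire_sets_subset[OF V[of i]]
        by (simp add: Collect_conj_eq Int_absorb1)
      with d have "(\<lambda>x. if x \<in> V i then d x else c) \<in> borel_measurable (baire_algebra X)"
        by (intro measurable_If) auto
      then have "(\<lambda>x\<in>topspace X. if x \<in> V i then d x else c) \<in> borel_measurable (baire_algebra X)"
        by (rule measurable_cong[THEN iffD1, rotated]) simp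
      with restrict_extensional show ?thesis
        unfolding baire_functions_eq by (rule IntI)
    qed
    then show "?S \<subseteq> baire_functions X"
      by (intro image_subsetI) (simp only: split_beta mem_Times_iff)
    fix f assume f: "f \<in> baire_functions X"
    obtain s :: "nat \<Rightarrow> _" where s: "(\<forall>n. s n \<in> D) \<and> (\<forall>x\<in>topspace X. (\<lambda>n. s n x) \<longlonglongrightarrow> f x)"
      using pointwise_sequence_in_seq_dense[OF D(2) f] ..
    define t where "t n = (\<lambda>x\<in>topspace X. if x \<in> V n then s n x else c)" for n
    have "t n \<in> ?S" for n
      unfolding t_def using s by (intro image_eqI[of _ _ "(n, s n)"]) simp_all
    moreover have "(\<lambda>n. t n x) \<longlonglongrightarrow> f x" if x: "x \<in> topspace X" for x
    proof (rule Lim_transform_eventually)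
      show "(\<lambda>n. s n x) \<longlonglongrightarrow> f x" using s x by blast
      show "\<forall>\<^sub>F n in sequentially. s n x = t n x"
        using cofin[OF x] by (rule eventually_mono) (use x in \<open>simp add: t_def\<close>)
    qed
    ultimately show "\<exists>s::nat \<Rightarrow> _. (\<forall>n. s n \<in> ?S) \<and> (\<forall>x\<in>topspace X. (\<lambda>n. s n x) \<longlonglongrightarrow> f x)"
      by (intro exI[of _ t]) simp
  qed
  then show ?thesis
    using D(1) by (simp add: countable_seq_dense_sets_iff)
qed

lemma baire_Gamma_enumeration:
  assumes "A \<in> baire_Gamma X"
  shows "\<exists>U::nat \<Rightarrow> _. range U = A \<and> (\<forall>x\<in>topspace X. \<forall>\<^sub>F i in sequentially. x \<in> U i)"
proof -
  have A: "countable A" "infinite A" and fin: "\<And>x. x \<in> topspace X \<Longrightarrow> finite {V \<in> A. x \<notin> V}"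
    using assms by (auto simp: baire_Gamma_def gamma_cover_def)
  define U where "U = from_nat_into A"
  have U: "range U = A" "inj U"
    using bij_betw_from_nat_into[OF A] by (simp_all add: U_def bij_betw_def)
  have "\<forall>\<^sub>F i in sequentially. x \<in> U i" if "x \<in> topspace X" for x
  proof -
    have "finite (U -` {V \<in> A. x \<notin> V})"
      using fin[OF that] U(2) by (rule finite_vimageI)
    moreover have "U -` {V \<in> A. x \<notin> V} = {i. \<not> x \<in> U i}"
      using U(1) by auto
    ultimately show ?thesis
      by (simp add: cofinite_eq_sequentially[symmetric] eventually_cofinite)
  qed
  with U(1) show ?thesis by blast
qed

text \<open>Selecting finitely many functions is as good as selecting one. The tails
  \<open>V n i = (\<Inter>j\<ge>i. U n j)\<close> of a \<open>\<gamma>\<close>-cover increase with \<open>i\<close> and still contain each point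
  eventually. Truncate the members of a sequentially dense set to the value \<open>1\<close> off \<open>V n i\<close>. A
  point at which one of finitely many truncated functions is close to \<open>0\<close> lies in one of
  finitely many tails, hence in the largest of them, hence in a single member of the cover.\<close>

lemma U_fin_seq_dense_Omega_at_imp_S_one_covers:
  assumes sep: "sequentially_separable (baire_function_space X)"
    and Ufin: "U_fin_seq_dense_Omega_at X (\<lambda>x\<in>topspace X. 0)"
  shows "S_one (baire_Gamma X) (baire_Omega X)"
  unfolding S_one_def
proof (intro allI impI)
  fix A :: "nat \<Rightarrow> 'a set set"
  assume A: "\<forall>n. A n \<in> baire_Gamma X"
  then have "\<forall>n. \<exists>U::nat \<Rightarrow> _. range U = A n \<and> (\<forall>x\<in>topspace X. \<forall>\<^sub>F i in sequentially. x \<in> U i)"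
    by (intro allI baire_Gamma_enumeration) simp
  from choice[OF this] obtain U :: "nat \<Rightarrow> nat \<Rightarrow> _" where
    U: "\<forall>n. range (U n) = A n \<and> (\<forall>x\<in>topspace X. \<forall>\<^sub>F i in sequentially. x \<in> U n i)" ..
  have UA: "U n i \<in> A n" for n i
    using U by blast
  have U_baire: "U n i \<in> baire_sets X" for n i
    using UA A by (auto simp: baire_Gamma_def)
  obtain D where D: "countable D" "sequentially_dense_in (baire_function_space X) D"
    using sep by (auto simp: sequentially_separable_def)
  define V where "V n i = (\<Inter>j\<in>{i..}. U n j)" for n i
  have V_mono: "V n i \<subseteq> V n j" if "i \<le> j" for n i j
    using that unfolding V_def by (intro INF_superset_mono) auto
  have V_U: "V n i \<subseteq> U n i" for n i
    by (auto simp: V_def)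
  have V_baire: "V n i \<in> baire_sets X" for n i
  proof -
    have "V n i \<in> sets (baire_algebra X)"
      unfolding V_def using U_baire by (intro sets.countable_INT') auto
    then show ?thesis by simp
  qed
  have V_cofin: "\<forall>\<^sub>F i in sequentially. x \<in> V n i" if "x \<in> topspace X" for n x
  proof -
    have "\<forall>\<^sub>F i in sequentially. x \<in> U n i"
      using U that by blast
    then have "\<forall>\<^sub>F i in sequentially. \<forall>j\<ge>i. x \<in> U n j"
      by (rule eventually_all_ge_at_top)
    then show ?thesis
      by (rule eventually_mono) (simp add: V_def)
  qed
  define S where
    "S n = (\<lambda>(i, d). \<lambda>x\<in>topspace X. if x \<in> V n i then d x else 1) ` (UNIV \<times> D)" for n
  have "\<forall>n. S n \<in> countable_seq_dense_sets (baire_function_space X)"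
    unfolding S_def by (intro allI truncations_seq_dense[OF V_baire V_cofin D])
  then have "\<exists>F. (\<forall>n. finite (F n) \<and> F n \<subseteq> S n) \<and>
      (\<forall>K \<epsilon>. finite K \<and> K \<subseteq> topspace X \<and> \<epsilon> > 0 \<longrightarrow>
        (\<exists>n. \<forall>x\<in>K. \<exists>g\<in>F n. \<bar>g x - (\<lambda>x\<in>topspace X. 0) x\<bar> < \<epsilon>))"
    using Ufin unfolding U_fin_seq_dense_Omega_at_def by simp
  then obtain F where F: "(\<forall>n. finite (F n) \<and> F n \<subseteq> S n) \<and>
      (\<forall>K \<epsilon>. finite K \<and> K \<subseteq> topspace X \<and> \<epsilon> > 0 \<longrightarrow>
        (\<exists>n. \<forall>x\<in>K. \<exists>g\<in>F n. \<bar>g x - (\<lambda>x\<in>topspace X. 0) x\<bar> < \<epsilon>))" ..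
  have "\<exists>m. \<forall>g\<in>F n. \<forall>x\<in>topspace X. \<bar>g x\<bar> < 1 \<longrightarrow> x \<in> U n m" for n
  proof -
    have "\<exists>i. \<forall>x\<in>topspace X. \<bar>g x\<bar> < 1 \<longrightarrow> x \<in> V n i" if "g \<in> F n" for g
    proof -
      have "g \<in> S n" using F that by blast
      then obtain i d where "g = (\<lambda>x\<in>topspace X. if x \<in> V n i then d x else 1)"
        by (auto simp: S_def)
      then show ?thesis
        by (intro exI[of _ i]) (auto split: if_splits)
    qed
    then obtain \<iota> where \<iota>: "\<And>g x. g \<in> F n \<Longrightarrow> x \<in> topspace X \<Longrightarrow> \<bar>g x\<bar> < 1 \<Longrightarrow> x \<in> V n (\<iota> g)"
      by metis
    define m where "m = Max (insert 0 (\<iota> ` F n))"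
    have "x \<in> U n m" if "g \<in> F n" "x \<in> topspace X" "\<bar>g x\<bar> < 1" for g x
    proof -
      have "\<iota> g \<le> m"
        unfolding m_def using F that(1) by (intro Max_ge) auto
      then show ?thesis
        using \<iota>[OF that] V_mono V_U by blast
    qed
    then show ?thesis by blast
  qed
  then obtain m where m: "\<And>n g x. g \<in> F n \<Longrightarrow> x \<in> topspace X \<Longrightarrow> \<bar>g x\<bar> < 1 \<Longrightarrow> x \<in> U n (m n)"
    by metis
  define b where "b n = U n (m n)" for n
  have bA: "b n \<in> A n" for n using UA by (simp add: b_def)
  have "\<exists>B\<in>range b. K \<subseteq> B" if K: "finite K" "K \<subseteq> topspace X" for K
  proof -
    obtain n where n: "\<forall>x\<in>K. \<exists>g\<in>F n. \<bar>g x - (\<lambda>x\<in>topspace X. 0) x\<bar> < 1"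
      using F K zero_less_one by blast
    have "x \<in> b n" if "x \<in> K" for x
    proof -
      have x: "x \<in> topspace X" using that K by auto
      obtain g where "g \<in> F n" "\<bar>g x - (\<lambda>x\<in>topspace X. 0) x\<bar> < 1"
        using n \<open>x \<in> K\<close> by blast
      with x have "x \<in> U n (m n)"
        by (intro m[of g]) simp_all
      then show ?thesis by (simp add: b_def)
    qed
    then show ?thesis by blast
  qed
  moreover have "b n \<in> baire_sets X \<and> b n \<subseteq> topspace X" for n
    using U_baire baire_sets_subset[OF U_baire] by (simp add: b_def)
  moreover have "topspace X \<noteq> b n" for n
    using A bA[of n] by (auto simp: baire_Gamma_def gamma_cover_def)
  ultimately have "range b \<in> baire_Omega X"
    by (simp add: baire_Omega_def omega_cover_def image_subset_iff image_iff)
  with bA show "\<exists>b. (\<forall>n. b n \<in> A n) \<and> range b \<in> baire_Omega X"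
    by blast
qed

lemma S_one_imp_S_fin:
  fixes P Q :: "'c set set"
  shows "S_one P Q \<Longrightarrow> S_fin P Q"
  unfolding S_one_def S_fin_def
proof (intro allI impI)
  fix A :: "nat \<Rightarrow> 'c set"
  assume "\<forall>A :: nat \<Rightarrow> 'c set. (\<forall>n. A n \<in> P) \<longrightarrow> (\<exists>b. (\<forall>n. b n \<in> A n) \<and> range b \<in> Q)" "\<forall>n. A n \<in> P"
  then obtain b where "(\<forall>n. b n \<in> A n) \<and> range b \<in> Q" by blast
  then show "\<exists>B. (\<forall>n. finite (B n) \<and> B n \<subseteq> A n) \<and> (\<Union>n. B n) \<in> Q"
    by (intro exI[of _ "\<lambda>n. {b n}"]) (simp add: UNION_singleton_eq_range)
qed

lemma S_fin_seq_dense_dense_imp_U_fin: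
  assumes Sfin: "S_fin (countable_seq_dense_sets (baire_function_space X))
    (countable_dense_sets (baire_function_space X))"
  shows "U_fin_seq_dense_dense X"
  unfolding U_fin_seq_dense_dense_def
proof (intro allI impI)
  fix S :: "nat \<Rightarrow> ('a \<Rightarrow> real) set"
  assume "\<forall>n. S n \<in> countable_seq_dense_sets (baire_function_space X)"
  then obtain B where B: "\<forall>n. finite (B n) \<and> B n \<subseteq> S n"
      "(\<Union>n. B n) \<in> countable_dense_sets (baire_function_space X)"
    using Sfin unfolding S_fin_def by meson
  have "\<exists>n. \<forall>x\<in>K. \<exists>g\<in>B n. \<bar>g x - f x\<bar> < \<epsilon>"
    if "f \<in> baire_functions X \<and> finite K \<and> K \<subseteq> topspace X \<and> \<epsilon> > 0" for f K \<epsilon>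
  proof -
    have "\<exists>g\<in>(\<Union>n. B n). \<forall>x\<in>K. \<bar>g x - f x\<bar> < \<epsilon>"
      using B(2) that unfolding countable_dense_baire_function_space by simp
    then show ?thesis by blast
  qed
  with B(1) show "\<exists>F. (\<forall>n. finite (F n) \<and> F n \<subseteq> S n) \<and>
      (\<forall>f K \<epsilon>. f \<in> baire_functions X \<and> finite K \<and> K \<subseteq> topspace X \<and> \<epsilon> > 0 \<longrightarrow>
        (\<exists>n. \<forall>x\<in>K. \<exists>g\<in>F n. \<bar>g x - f x\<bar> < \<epsilon>))"
    by (intro exI[of _ B]) simp
qed

lemma S_fin_seq_dense_Omega_at_imp_U_fin:
  assumes Sfin: "S_fin (countable_seq_dense_sets (baire_function_space X))
    (Omega_at (baire_function_space X) f)"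
  shows "U_fin_seq_dense_Omega_at X f"
  unfolding U_fin_seq_dense_Omega_at_def
proof (intro allI impI)
  fix S :: "nat \<Rightarrow> ('a \<Rightarrow> real) set"
  assume "\<forall>n. S n \<in> countable_seq_dense_sets (baire_function_space X)"
  then obtain B where B: "\<forall>n. finite (B n) \<and> B n \<subseteq> S n"
      "(\<Union>n. B n) \<in> Omega_at (baire_function_space X) f"
    using Sfin unfolding S_fin_def by meson
  have "\<exists>n. \<forall>x\<in>K. \<exists>g\<in>B n. \<bar>g x - f x\<bar> < \<epsilon>"
    if "finite K \<and> K \<subseteq> topspace X \<and> \<epsilon> > 0" for K \<epsilon>
  proof -
    have "\<exists>g\<in>(\<Union>n. B n). \<forall>x\<in>K. \<bar>g x - f x\<bar> < \<epsilon>"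
      using B(2) that unfolding Omega_at_baire_function_space by simp
    then show ?thesis by blast
  qed
  with B(1) show "\<exists>F. (\<forall>n. finite (F n) \<and> F n \<subseteq> S n) \<and>
      (\<forall>K \<epsilon>. finite K \<and> K \<subseteq> topspace X \<and> \<epsilon> > 0 \<longrightarrow>
        (\<exists>n. \<forall>x\<in>K. \<exists>g\<in>F n. \<bar>g x - f x\<bar> < \<epsilon>))"
    by (intro exI[of _ B]) simp
qed

lemma U_fin_seq_dense_dense_imp_Omega_at:
  assumes U: "U_fin_seq_dense_dense X" and f: "f \<in> baire_functions X"
  shows "U_fin_seq_dense_Omega_at X f"
  unfolding U_fin_seq_dense_Omega_at_def
proof (intro allI impI)
  fix S :: "nat \<Rightarrow> ('a \<Rightarrow> real) set"
  assume "\<forall>n. S n \<in> countable_seq_dense_sets (baire_function_space X)"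
  with U have "\<exists>F. (\<forall>n. finite (F n) \<and> F n \<subseteq> S n) \<and>
      (\<forall>f K \<epsilon>. f \<in> baire_functions X \<and> finite K \<and> K \<subseteq> topspace X \<and> \<epsilon> > 0 \<longrightarrow>
        (\<exists>n. \<forall>x\<in>K. \<exists>g\<in>F n. \<bar>g x - f x\<bar> < \<epsilon>))"
    unfolding U_fin_seq_dense_dense_def by simp
  then obtain F where "(\<forall>n. finite (F n) \<and> F n \<subseteq> S n) \<and>
      (\<forall>f K \<epsilon>. f \<in> baire_functions X \<and> finite K \<and> K \<subseteq> topspace X \<and> \<epsilon> > 0 \<longrightarrow>
        (\<exists>n. \<forall>x\<in>K. \<exists>g\<in>F n. \<bar>g x - f x\<bar> < \<epsilon>))" ..
  with f show "\<exists>F. (\<forall>n. finite (F n) \<and> F n \<subseteq> S n) \<and>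
      (\<forall>K \<epsilon>. finite K \<and> K \<subseteq> topspace X \<and> \<epsilon> > 0 \<longrightarrow>
        (\<exists>n. \<forall>x\<in>K. \<exists>g\<in>F n. \<bar>g x - f x\<bar> < \<epsilon>))"
    by (intro exI[of _ F]) simp
qed

section \<open>The equivalence\<close>

theorem theorem6p2:
  fixes X :: "'a topology"
  assumes "completely_regular_space X" and "Hausdorff_space X"
    and "topspace X \<noteq> {}"
  shows "all_equivalent
    [sequentially_separable (baire_function_space X) \<and>
       S_one (countable_seq_dense_sets (baire_function_space X))
             (countable_dense_sets (baire_function_space X)),
     S_one (baire_Gamma X) (baire_Omega X) \<and> O_property X,
     sequentially_separable (baire_function_space X) \<and>
       (\<forall>f \<in> baire_functions X.
          S_one (Gamma_at (baire_function_space X) f) (Omega_at (baire_function_space X) f)),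
     sequentially_separable (baire_function_space X) \<and>
       (\<forall>f \<in> baire_functions X.
          S_one (countable_seq_dense_sets (baire_function_space X))
                (Omega_at (baire_function_space X) f)),
     sequentially_separable (baire_function_space X) \<and>
       S_fin (countable_seq_dense_sets (baire_function_space X))
             (countable_dense_sets (baire_function_space X)),
     sequentially_separable (baire_function_space X) \<and>
       U_fin_seq_dense_dense X,
     sequentially_separable (baire_function_space X) \<and>
       (\<forall>f \<in> baire_functions X.
          S_fin (countable_seq_dense_sets (baire_function_space X))
                (Omega_at (baire_function_space X) f)),
     sequentially_separable (baire_function_space X) \<and>
       (\<forall>f \<in> baire_functions X. U_fin_seq_dense_Omega_at X f)]"
    (is "all_equivalent [?P1, ?P2, ?P3, ?P4, ?P5, ?P6, ?P7, ?P8]")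
proof -
  have "?P1 \<Longrightarrow> ?P5"
    by (simp add: S_one_imp_S_fin)
  moreover have "?P5 \<Longrightarrow> ?P6"
    by (simp add: S_fin_seq_dense_dense_imp_U_fin)
  moreover have "?P6 \<Longrightarrow> ?P8"
    by (simp add: U_fin_seq_dense_dense_imp_Omega_at)
  moreover have "?P4 \<Longrightarrow> ?P7"
    by (simp add: S_one_imp_S_fin)
  moreover have "?P7 \<Longrightarrow> ?P8"
    by (simp add: S_fin_seq_dense_Omega_at_imp_U_fin)
  moreover have "?P3 \<Longrightarrow> ?P8"
    by (simp add: S_one_Gamma_at_imp_U_fin_seq_dense)
  moreover have "?P8 \<Longrightarrow> ?P2"
    using U_fin_seq_dense_Omega_at_imp_S_one_covers[of X] baire_functions_const[of 0 X]
      sequentially_separable_imp_O_property[OF assms(1,2)] by simp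
  moreover have "?P1 \<and> ?P3 \<and> ?P4" if ?P2
  proof -
    from that have S1: "S_one (baire_Gamma X) (baire_Omega X)" and "O_property X" by simp_all
    then have sep: "sequentially_separable (baire_function_space X)"
      using O_property_imp_sequentially_separable by blast
    with S1 assms(3) show ?thesis
      by (simp add: S_one_covers_imp_S_one_seq_dense_dense
          S_one_covers_imp_S_one_Gamma_at_Omega_at S_one_covers_imp_S_one_seq_dense_Omega_at)
  qed
  ultimately show ?thesis
    unfolding all_equivalent_def list.set ball_simps by argo
qed

end
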